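(* Let $0\le\alpha,\beta<1$ and $n\in\mathbb{N}$. For every integer $s\ge n$, the functions $\varphi_s^+$ and $\varphi_s^-$ belong to the minimal domain $\mathcal{D}_{\min}^{\mathbf{J},n}$ associated with the $n$th composition of the Jacobi differential expression.
   Context: $\mathbb{N}=\{1,2,\dots\}$. Put $w(x)=(1-x)^\alpha(1+x)^\beta$ and $L^2_{\alpha,\beta}(-1,1)=L^2((-1,1),w\,dx)$. The Jacobi differential expression is $\ell_{\alpha,\beta}[f]=-\frac{1}{w}\left[(1-x)^{\alpha+1}(1+x)^{\beta+1}f'\right]'$, and $\ell^n_{\mathbf{J}}$ denotes its $n$-fold composition with itself. It has a Lagrangian symmetric form $\ell^n_{\mathbf{J}}[f]=\frac1w\sum_{k=1}^n(-1)^k\left[a_kf^{(k)}\right]^{(k)}$ with $a_k(x)=C(n,k,\alpha,\beta)(1-x)^{\alpha+k}(1+x)^{\beta+k}$ for certain constants $C(n,k,\alpha,\beta)$ (determined by this identity). The maximal domain is $$\mathcal{D}_{\max}^{\mathbf{J},n}=\{f\in L^2_{\alpha,\beta}(-1,1): f,f',\dots,f^{(2n-1)}\in AC_{\mathrm{loc}}(-1,1),\ \ell^n_{\mathbf{J}}[f]\in L^2_{\alpha,\beta}(-1,1)\}.$$ For $f,g\in\mathcal{D}_{\max}^{\mathbf{J},n}$ the sesquilinear form is $$[f,g]_n(x)=\sum_{k=1}^n\sum_{j=1}^k(-1)^{k+j}\Big\{\big[a_k\overline{g}^{(k)}\big]^{(k-j)}f^{(j-1)}-\big[a_kf^{(k)}\big]^{(k-j)}\overline{g}^{(j-1)}\Big\}(x),$$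 with $[f,g]_n(\pm1)$ the (finite) limits at the endpoints, so that by Green's formula $[f,g]_n\big|_{-1}^1=[f,g]_n(1)-[f,g]_n(-1)=\int_{-1}^1(\ell^n_{\mathbf{J}}[f]\overline g-f\,\overline{\ell^n_{\mathbf{J}}[g]})w\,dx$. The minimal domain is $\mathcal{D}_{\min}^{\mathbf{J},n}=\{f\in\mathcal{D}_{\max}^{\mathbf{J},n}:[f,g]_n\big|_{-1}^1=0\ \forall g\in\mathcal{D}_{\max}^{\mathbf{J},n}\}$. For $j\in\mathbb{N}_0$, $\varphi_j^+\in C^\infty[-1,1]$ denotes a (fixed) function equal to $(1-x)^j$ for $x$ near $1$ and equal to $0$ for $x$ near $-1$; $\varphi_j^-\in C^\infty[-1,1]$ denotes a (fixed) function equal to $0$ for $x$ near $1$ and equal to $(1+x)^j$ for $x$ near $-1$. *)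

theory Defs
  imports "HOL-Analysis.Analysis"
begin

text \<open>Functions on the open interval are total functions \<^typ>\<open>real \<Rightarrow> complex\<close>; their values
  outside it (for smoothness up to the boundary: outside the closed interval) play no role.\<close>

text \<open>At a point where \<open>g\<close> is not differentiable, \<open>vector_derivative g (at x)\<close> is an
  unspecified value, so differentiability is always required separately (or holds almost
  everywhere, in the case of the highest derivative on the maximal domain).\<close>

definition nderiv :: "nat \<Rightarrow> (real \<Rightarrow> complex) \<Rightarrow> real \<Rightarrow> complex" where
  "nderiv k f = ((\<lambda>g x. vector_derivative g (at x)) ^^ k) f"

definition times_differentiable :: "nat \<Rightarrow> (real \<Rightarrow> complex) \<Rightarrow> bool" where
  "times_differentiable m f \<longleftrightarrow>
     (\<forall>j<m. \<forall>x\<in>{-1<..<1}. nderiv j f differentiable (at x))"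

definition abs_continuous_on :: "real set \<Rightarrow> (real \<Rightarrow> complex) \<Rightarrow> bool" where
  "abs_continuous_on S f \<longleftrightarrow>
     (\<forall>\<epsilon>>0. \<exists>\<delta>>0. \<forall>D T. D division_of T \<longrightarrow> T \<subseteq> S \<longrightarrow> (\<Sum>K\<in>D. measure lborel K) < \<delta> \<longrightarrow>
        (\<Sum>K\<in>D. norm (f (Sup K) - f (Inf K))) < \<epsilon>)"

definition AC_loc :: "(real \<Rightarrow> complex) \<Rightarrow> bool" where
  "AC_loc f \<longleftrightarrow> (\<forall>a b. -1 < a \<longrightarrow> a < b \<longrightarrow> b < 1 \<longrightarrow> abs_continuous_on {a..b} f)"

definition jacobi_weight :: "real \<Rightarrow> real \<Rightarrow> real \<Rightarrow> real" where
  "jacobi_weight \<alpha> \<beta> x = (1 - x) powr \<alpha> * (1 + x) powr \<beta>"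

definition L2_jacobi :: "real \<Rightarrow> real \<Rightarrow> (real \<Rightarrow> complex) set" where
  "L2_jacobi \<alpha> \<beta> =
     {f. f \<in> borel_measurable (lebesgue_on {-1<..<1}) \<and>
         integrable (lebesgue_on {-1<..<1}) (\<lambda>x. (norm (f x))\<^sup>2 * jacobi_weight \<alpha> \<beta> x)}"

definition jacobi_expr :: "real \<Rightarrow> real \<Rightarrow> (real \<Rightarrow> complex) \<Rightarrow> real \<Rightarrow> complex" where
  "jacobi_expr \<alpha> \<beta> f x =
     - (1 / of_real (jacobi_weight \<alpha> \<beta> x)) *
       nderiv 1 (\<lambda>y. of_real ((1 - y) powr (\<alpha> + 1) * (1 + y) powr (\<beta> + 1)) * nderiv 1 f y) x"

definition jacobi_expr_pow :: "nat \<Rightarrow> real \<Rightarrow> real \<Rightarrow> (real \<Rightarrow> complex) \<Rightarrow> real \<Rightarrow> complex" where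
  "jacobi_expr_pow n \<alpha> \<beta> = jacobi_expr \<alpha> \<beta> ^^ n"

definition lagrangian_coeff ::
    "(nat \<Rightarrow> real) \<Rightarrow> real \<Rightarrow> real \<Rightarrow> nat \<Rightarrow> real \<Rightarrow> complex" where
  "lagrangian_coeff C \<alpha> \<beta> k x = of_real (C k * (1 - x) powr (\<alpha> + k) * (1 + x) powr (\<beta> + k))"

definition is_lagrangian_form :: "nat \<Rightarrow> real \<Rightarrow> real \<Rightarrow> (nat \<Rightarrow> real) \<Rightarrow> bool" where
  "is_lagrangian_form n \<alpha> \<beta> C \<longleftrightarrow>
     (\<forall>f. times_differentiable (2 * n) f \<longrightarrow>
        (\<forall>x\<in>{-1<..<1}.
           jacobi_expr_pow n \<alpha> \<beta> f x =
           (1 / of_real (jacobi_weight \<alpha> \<beta> x)) *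
             (\<Sum>k=1..n. (-1) ^ k * nderiv k (\<lambda>y. lagrangian_coeff C \<alpha> \<beta> k y * nderiv k f y) x)))"

text \<open>The identity determines \<open>C k\<close> only for \<open>1 \<le> k \<le> n\<close>; the normalisation outside this range
  (where \<open>C\<close> is never used) makes the definite description well defined.\<close>

definition jacobi_const :: "nat \<Rightarrow> real \<Rightarrow> real \<Rightarrow> nat \<Rightarrow> real" where
  "jacobi_const n \<alpha> \<beta> =
     (THE C. is_lagrangian_form n \<alpha> \<beta> C \<and> (\<forall>k. k \<notin> {1..n} \<longrightarrow> C k = 0))"

definition jacobi_coeff :: "nat \<Rightarrow> real \<Rightarrow> real \<Rightarrow> nat \<Rightarrow> real \<Rightarrow> complex" where
  "jacobi_coeff n \<alpha> \<beta> = lagrangian_coeff (jacobi_const n \<alpha> \<beta>) \<alpha> \<beta>"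

definition D_max :: "nat \<Rightarrow> real \<Rightarrow> real \<Rightarrow> (real \<Rightarrow> complex) set" where
  "D_max n \<alpha> \<beta> =
     {f. f \<in> L2_jacobi \<alpha> \<beta> \<and>
         times_differentiable (2 * n - 1) f \<and> (\<forall>j\<le>2 * n - 1. AC_loc (nderiv j f)) \<and>
         jacobi_expr_pow n \<alpha> \<beta> f \<in> L2_jacobi \<alpha> \<beta>}"

definition jacobi_form ::
    "nat \<Rightarrow> real \<Rightarrow> real \<Rightarrow> (real \<Rightarrow> complex) \<Rightarrow> (real \<Rightarrow> complex) \<Rightarrow> real \<Rightarrow> complex" where
  "jacobi_form n \<alpha> \<beta> f g x =
     (\<Sum>k=1..n. \<Sum>j=1..k. (-1) ^ (k + j) *
        (nderiv (k - j) (\<lambda>y. jacobi_coeff n \<alpha> \<beta> k y * nderiv k (\<lambda>z. cnj (g z)) y) x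
           * nderiv (j - 1) f x
       - nderiv (k - j) (\<lambda>y. jacobi_coeff n \<alpha> \<beta> k y * nderiv k f y) x
           * nderiv (j - 1) (\<lambda>z. cnj (g z)) x))"

text \<open>The existence of the finite limits at the endpoints is part of the condition, because the
  difference of two nonexistent limits \<^const>\<open>Lim\<close> would be \<open>0\<close>.\<close>

definition D_min :: "nat \<Rightarrow> real \<Rightarrow> real \<Rightarrow> (real \<Rightarrow> complex) set" where
  "D_min n \<alpha> \<beta> =
     {f \<in> D_max n \<alpha> \<beta>. \<forall>g \<in> D_max n \<alpha> \<beta>. \<exists>u v.
        (jacobi_form n \<alpha> \<beta> f g \<longlongrightarrow> u) (at_left 1) \<and>
        (jacobi_form n \<alpha> \<beta> f g \<longlongrightarrow> v) (at_right (-1)) \<and> u - v = 0}"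

text \<open>Smoothness on the closed interval, with one-sided derivatives at the endpoints;
  \<open>d k\<close> is the \<open>k\<close>-th derivative.\<close>

definition smooth_on_Icc :: "(real \<Rightarrow> complex) \<Rightarrow> bool" where
  "smooth_on_Icc f \<longleftrightarrow>
     (\<exists>d. d 0 = f \<and>
        (\<forall>k. \<forall>x\<in>{-1..1}. (d k has_vector_derivative d (Suc k) x) (at x within {-1..1})))"

definition is_phi_plus :: "nat \<Rightarrow> (real \<Rightarrow> complex) \<Rightarrow> bool" where
  "is_phi_plus j \<phi> \<longleftrightarrow> smooth_on_Icc \<phi> \<and>
     (\<exists>\<delta>>0. \<forall>x\<in>{-1..1}. (1 - \<delta> < x \<longrightarrow> \<phi> x = of_real ((1 - x) ^ j)) \<and>
                          (x < -1 + \<delta> \<longrightarrow> \<phi> x = 0))"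

definition is_phi_minus :: "nat \<Rightarrow> (real \<Rightarrow> complex) \<Rightarrow> bool" where
  "is_phi_minus j \<phi> \<longleftrightarrow> smooth_on_Icc \<phi> \<and>
     (\<exists>\<delta>>0. \<forall>x\<in>{-1..1}. (1 - \<delta> < x \<longrightarrow> \<phi> x = 0) \<and>
                          (x < -1 + \<delta> \<longrightarrow> \<phi> x = of_real ((1 + x) ^ j)))"

end

theory Submission
  imports Defs
begin

text \<open>The limits of every single term of the form \<open>[\<phi>, g]\<^sub>n\<close> vanish, whatever the values of the constants
  \<open>C(n, k, \<alpha>, \<beta>)\<close>, so neither the Lagrangian identity nor Green's formula is needed.
  With \<open>W a b x = (1 - x)\<^sup>a (1 + x)\<^sup>b\<close>, a function \<open>g\<close> of the maximal domain satisfies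
  \<open>g\<^sup>(\<^sup>j\<^sup>) = O(W (-\<alpha>-1/2-j) (-\<beta>-1/2-j))\<close> for \<open>j < 2n\<close>: the flux \<open>(1-x)\<^sup>\<alpha>\<^sup>+\<^sup>1 (1+x)\<^sup>\<beta>\<^sup>+\<^sup>1 u'\<close> of
  \<open>u = \<ell>\<^sup>n\<^sup>-\<^sup>1[g]\<close> is locally absolutely continuous with integrable derivative \<open>-w \<ell>\<^sup>n[g]\<close>, hence bounded, and
  integrating the Jacobi equation \<open>n\<close> times propagates the estimate down to \<open>g\<close>. Since
  \<open>\<phi>\<^sup>(\<^sup>j\<^sup>) = O(W (s-j) (s-j))\<close>, each term of the form is \<open>O(W (1/2) (1/2))\<close>.
  That an absolutely continuous function is the integral of its almost everywhere derivative
  is derived from the Vitali covering theorem.\<close>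

subsection \<open>Almost everywhere differentiability of absolutely continuous functions\<close>

text \<open>The obstacle is that \<open>D_max\<close> says nothing pointwise at the ends: membership
  is an \<open>L2_jacobi\<close> condition on \<open>jacobi_expr_pow n \<alpha> \<beta> g\<close>,
  and the derivative of order 2n in it exists only almost everywhere. Measure theory is confined to
  the outermost application of \<open>jacobi_expr\<close>; for the inner ones the equation is
  classical. The bookkeeping is done by the classes \<open>wbounded m a b\<close>, in which every
  derivative lowers both exponents by one. Weights belong to them and products add exponents, so
  every estimate becomes arithmetic of exponents. The exponents -(\<alpha> + 1/2) and -(\<beta> +
  1/2) reproduce themselves: multiplying by the weight, integrating, dividing by the leading
  coefficient and integrating again leads back to them, however often this is iterated. The shift
  1/2 is a price paid once. In the terms of the form with k = n the exponents balance to 1 minus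
  this shift, so a shift below 1 still leaves decay.\<close>

definition chord_near :: "real \<Rightarrow> real \<Rightarrow> real \<Rightarrow> real \<Rightarrow> bool" where
  "chord_near x d u v \<longleftrightarrow> u < v \<and> u \<le> x \<and> x \<le> v \<and> v - u < d"

definition var_sum :: "(real \<Rightarrow> real) \<Rightarrow> real set set \<Rightarrow> real" where
  "var_sum f D = (\<Sum>K\<in>D. \<bar>f (Sup K) - f (Inf K)\<bar>)"

text \<open>Tagging every cell with its left end turns the division into a tagged one, for which the
  sum telescopes.\<close>

lemma sum_increments_division:
  fixes f :: "real \<Rightarrow> 'a::real_normed_vector"
  assumes "D division_of {a..b}" "a \<le> b"
  shows "(\<Sum>K\<in>D. f (Sup K) - f (Inf K)) = f b - f a"
proof -
  have "(\<lambda>K. (Inf K, K)) ` D tagged_division_of {a..b}"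
  proof (rule tagged_division_ofI)
    note D = division_ofD[OF assms(1)]
    show "finite ((\<lambda>K. (Inf K, K)) ` D)" using D(1) by auto
    fix x K assume "(x, K) \<in> (\<lambda>K. (Inf K, K)) ` D"
    then have K: "K \<in> D" "x = Inf K" by auto
    obtain c d where cd: "K = cbox c d" using D(4) K by blast
    moreover have "K \<noteq> {}" using D(3) K by blast
    ultimately show "x \<in> K" using K by auto
    show "K \<subseteq> {a..b}" using D(2) K by blast
    show "\<exists>a b. K = cbox a b" using cd by blast
    fix y L assume "(y, L) \<in> (\<lambda>K. (Inf K, K)) ` D" "(x, K) \<noteq> (y, L)"
    then show "interior K \<inter> interior L = {}" using D(5) K by auto
  next
    have "{K. \<exists>x. (x, K) \<in> (\<lambda>K. (Inf K, K)) ` D} = D" by blast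
    then show "\<Union>{K. \<exists>x. (x, K) \<in> (\<lambda>K. (Inf K, K)) ` D} = {a..b}"
      using division_ofD(6)[OF assms(1)] by simp
  qed
  from additive_tagged_division_1[OF assms(2) this, of f] show ?thesis
    by (subst (asm) sum.reindex) (auto simp: inj_on_def)
qed

section \<open>Null sets of badly behaved slopes, from Vitali covers\<close>

text \<open>By Vitali's theorem countably many disjoint intervals with property \<open>P\<close>
  cover \<open>S\<close> up to a null set. Finite subfamilies are divisions of their unions, so
  \<open>bound\<close> applies to them and passes to the countable union. An outer measure estimate
  is thereby reduced to one on finite divisions.\<close>

lemma vitali_interval_cover:
  assumes cover: "\<And>x d. x \<in> S \<Longrightarrow> d > 0 \<Longrightarrow> \<exists>u v. chord_near x d u v \<and> P u v"
    and bound: "\<And>D. finite D \<Longrightarrow> D division_of \<Union>D \<Longrightarrow>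
                  (\<And>K. K \<in> D \<Longrightarrow> \<exists>u v. u < v \<and> K = {u..v} \<and> P u v) \<Longrightarrow>
                  (\<Sum>K\<in>D. measure lborel K) \<le> e"
  obtains T where "S \<subseteq> T" "T \<in> lmeasurable" "measure lebesgue T \<le> e"
proof -
  define K where "K = {(u, v). u < v \<and> P u v}"
  define a where "a = (\<lambda>(u, v). (u + v) / 2 :: real)"
  define r where "r = (\<lambda>(u, v). (v - u) / 2 :: real)"
  have cb: "cball (a i) (r i) = {fst i..snd i}" for i
    by (auto simp: a_def r_def cball_def dist_real_def split: prod.splits) (auto simp: field_simps abs_if split: if_splits)
  obtain C where C: "countable C" "C \<subseteq> K"
    "pairwise (\<lambda>i j. disjnt (cball (a i) (r i)) (cball (a j) (r j))) C"
    "negligible (S - (\<Union>i\<in>C. cball (a i) (r i)))"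
  proof (rule Vitali_covering_theorem_cballs[of K r S a])
    show "0 < r i" if "i \<in> K" for i using that by (auto simp: K_def r_def)
    show "\<exists>i. i \<in> K \<and> x \<in> cball (a i) (r i) \<and> r i < d" if xd: "x \<in> S" "0 < d" for x d
    proof -
      obtain u v where "chord_near x d u v" "P u v" using cover[OF xd] by blast
      then show ?thesis unfolding cb
        by (intro exI[of _ "(u, v)"]) (auto simp: K_def r_def chord_near_def)
    qed
  qed
  have C3: "pairwise (\<lambda>i j. disjnt {fst i..snd i} {fst j..snd j}) C" using C(3) by (simp add: cb)
  have fin: "measure lebesgue (\<Union>i\<in>I. {fst i..snd i}) \<le> e" if I: "I \<subseteq> C" "finite I" for I
  proof -
    define D where "D = (\<lambda>i. {fst i..snd i}) ` I"
    have lt: "fst i < snd i" "P (fst i) (snd i)" if "i \<in> I" for i using that I C(2) by (auto simp: K_def)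
    have D: "finite D" "D division_of \<Union>D"
    proof -
      show "finite D" using I by (auto simp: D_def)
      show "D division_of \<Union>D"
      proof (rule division_ofI)
        show "finite D" by fact
        fix L assume L: "L \<in> D"
        then obtain i where i: "i \<in> I" "L = {fst i..snd i}" by (auto simp: D_def)
        show "L \<subseteq> \<Union>D" using L by blast
        show "L \<noteq> {}" using i lt[OF i(1)] by auto
        show "\<exists>a b. L = cbox a b" using i by (metis box_real(2))
        fix M assume "M \<in> D" "L \<noteq> M"
        then obtain j where j: "j \<in> I" "M = {fst j..snd j}" "i \<noteq> j" using i by (auto simp: D_def)
        have "disjnt L M" using C3 i j I(1) by (auto simp: pairwise_def)
        then show "interior L \<inter> interior M = {}"
          by (meson disjnt_def disjoint_iff interior_subset subsetD)
      qed simp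
    qed
    have "measure lebesgue (\<Union>i\<in>I. {fst i..snd i}) = measure lebesgue (\<Union>D)" by (simp add: D_def)
    also have "\<dots> \<le> (\<Sum>K\<in>D. measure lebesgue K)"
      using D(1) by (intro measure_Union_le) (auto simp: D_def)
    also have "\<dots> = (\<Sum>K\<in>D. measure lborel K)" by (intro sum.cong) (auto simp: D_def)
    also have "\<dots> \<le> e" by (rule bound[OF D]) (use lt in \<open>force simp: D_def\<close>)
    finally show ?thesis .
  qed
  let ?U = "\<Union>i\<in>C. {fst i..snd i}"
  have U: "?U \<in> lmeasurable \<and> measure lebesgue ?U \<le> e"
    using fmeasurable_UN_bound[OF C(1), of "\<lambda>i. {fst i..snd i}" lebesgue e]
      measure_UN_bound[OF C(1), of "\<lambda>i. {fst i..snd i}" lebesgue e] fin by fastforce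
  have N: "negligible (S - ?U)" using C(4) by (simp add: cb)
  have m: "?U \<union> (S - ?U) \<in> lmeasurable" using U N by (intro fmeasurable.Un) (simp_all add: negligible_imp_measurable)
  have "measure lebesgue (?U \<union> (S - ?U)) \<le> measure lebesgue ?U + measure lebesgue (S - ?U)"
    using U N by (intro measure_Un_le) (auto simp: negligible_imp_sets fmeasurableD)
  also have "\<dots> \<le> e" using U N by (simp add: negligible_imp_measure0)
  finally show ?thesis using m by (intro that[of "?U \<union> (S - ?U)"]) auto
qed

text \<open>With \<open>s\<close> the sign of the total increment, the signed increments telescope
  to its absolute value. A cell of \<open>E\<close> runs against this sign, so its absolute
  increment exceeds its signed one by at least \<open>2 * r\<close> times its length.\<close>

lemma var_sum_counter_slopes:
  assumes q: "q division_of {c..d}" "c \<le> d" and E: "E \<subseteq> q" and s: "\<bar>s\<bar> = 1"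
    and sgn: "s * (f d - f c) \<ge> 0"
    and dec: "\<And>J. J \<in> E \<Longrightarrow> s * (f (Sup J) - f (Inf J)) \<le> - r * measure lborel J"
    and r: "r \<ge> 0"
  shows "\<bar>f d - f c\<bar> + 2 * r * (\<Sum>J\<in>E. measure lborel J) \<le> var_sum f q"
proof -
  have fin: "finite q" using q by blast
  let ?D = "\<lambda>J. f (Sup J) - f (Inf J)"
  have abss: "\<bar>s * x\<bar> = \<bar>x\<bar>" for x using s by (simp add: abs_mult)
  have "\<bar>f d - f c\<bar> = s * (f d - f c)" using sgn abss by (metis abs_of_nonneg)
  also have "\<dots> = (\<Sum>J\<in>q. s * ?D J)"
    using sum_increments_division[OF q, of f] by (simp add: sum_distrib_left[symmetric])
  finally have 1: "\<bar>f d - f c\<bar> = (\<Sum>J\<in>q. s * ?D J)" .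
  have 2: "2 * r * (\<Sum>J\<in>E. measure lborel J) = (\<Sum>J\<in>q. if J \<in> E then 2 * r * measure lborel J else 0)"
    using fin E by (simp add: sum_distrib_left sum.inter_restrict[symmetric] Int_absorb1)
  have "\<bar>f d - f c\<bar> + 2 * r * (\<Sum>J\<in>E. measure lborel J)
      = (\<Sum>J\<in>q. s * ?D J + (if J \<in> E then 2 * r * measure lborel J else 0))"
    unfolding 1 2 by (simp add: sum.distrib)
  also have "\<dots> \<le> (\<Sum>J\<in>q. \<bar>?D J\<bar>)"
  proof (rule sum_mono)
    fix J assume "J \<in> q"
    show "s * ?D J + (if J \<in> E then 2 * r * measure lborel J else 0) \<le> \<bar>?D J\<bar>"
    proof (cases "J \<in> E")
      case True
      have "r * measure lborel J \<ge> 0" using r by simp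
      then show ?thesis using dec[OF True] True abss[of "?D J"] by (simp add: algebra_simps)
    next
      case False
      then show ?thesis using abss[of "?D J"] by simp
    qed
  qed
  finally show ?thesis by (simp add: var_sum_def)
qed

text \<open>A one-point cell at a common end could lie in the refinements of two neighbouring cells.
  Nonempty interiors exclude this, so the families \<open>q K\<close> are disjoint and their
  variation sums add up.\<close>

lemma division_of_refine:
  assumes D: "D division_of {a..b::real}"
    and q: "\<And>K. K \<in> D \<Longrightarrow> q K division_of K"
    and nt: "\<And>K J. K \<in> D \<Longrightarrow> J \<in> q K \<Longrightarrow> interior J \<noteq> {}"
  shows "\<Union>(q ` D) division_of {a..b}" "var_sum f (\<Union>(q ` D)) = (\<Sum>K\<in>D. var_sum f (q K))"
proof -
  note DD = division_ofD[OF D]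
  have sub: "J \<subseteq> K" if "K \<in> D" "J \<in> q K" for J K using division_ofD(2)[OF q] that by blast
  have ij: "interior J \<inter> interior L = {}" if "K \<in> D" "M \<in> D" "K \<noteq> M" "J \<in> q K" "L \<in> q M" for J L K M
    using DD(5)[OF that(1-3)] sub that interior_mono by (metis (no_types) Int_mono bot.extremum_uniqueI)
  show "\<Union>(q ` D) division_of {a..b}"
  proof (rule division_ofI)
    show "finite (\<Union>(q ` D))" using DD(1) q by blast
    fix J assume "J \<in> \<Union>(q ` D)"
    then obtain K where K: "K \<in> D" "J \<in> q K" by blast
    show "J \<subseteq> {a..b}" using sub K DD(2) by blast
    show "J \<noteq> {}" "\<exists>a b. J = cbox a b" using division_ofD(3,4)[OF q] K by blast+
    fix L assume "L \<in> \<Union>(q ` D)" "J \<noteq> L"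
    then obtain M where M: "M \<in> D" "L \<in> q M" by blast
    show "interior J \<inter> interior L = {}"
      using ij[of K M J L] K M division_ofD(5)[OF q[OF K(1)]] \<open>J \<noteq> L\<close> by (cases "K = M") auto
  next
    have "\<Union>(\<Union>(q ` D)) = (\<Union>K\<in>D. \<Union>(q K))" by blast
    also have "\<dots> = \<Union>D" using division_ofD(6)[OF q] by simp
    finally show "\<Union>(\<Union>(q ` D)) = {a..b}" using DD(6) by simp
  qed
  show "var_sum f (\<Union>(q ` D)) = (\<Sum>K\<in>D. var_sum f (q K))"
    unfolding var_sum_def
  proof (rule sum.UNION_disjoint)
    show "finite D" by fact
    show "\<forall>K\<in>D. finite (q K)" using q by blast
    show "\<forall>K\<in>D. \<forall>M\<in>D. K \<noteq> M \<longrightarrow> q K \<inter> q M = {}"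
      using ij nt by (metis Int_absorb disjoint_iff)
  qed
qed

lemma sum_UNION_nonneg_le:
  fixes g :: "'a \<Rightarrow> real"
  assumes "finite D" "\<And>K. K \<in> D \<Longrightarrow> finite (E K)" "\<And>x. g x \<ge> 0"
  shows "sum g (\<Union>K\<in>D. E K) \<le> (\<Sum>K\<in>D. sum g (E K))"
  using assms(1,2)
proof (induction D)
  case (insert K D)
  have "sum g (E K \<union> (\<Union>K\<in>D. E K)) \<le> sum g (E K) + sum g (\<Union>K\<in>D. E K)"
    using insert.hyps insert.prems assms(3) by (subst sum.union_inter[symmetric]) (auto intro!: sum_nonneg)
  then show ?case using insert by fastforce
qed simp

text \<open>Austin's argument: if a division nearly attains the total variation, then within each cell
  the chords whose slope has the sign opposite to the increment over that cell have small total length.\<close>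

lemma negligible_oscillating_slopes:
  fixes f :: "real \<Rightarrow> real"
  assumes ab: "a < b" and B: "\<And>D. D division_of {a..b} \<Longrightarrow> var_sum f D \<le> B" and r: "r > 0"
  shows "negligible {x \<in> {a<..<b}. \<forall>d>0. (\<exists>u v. chord_near x d u v \<and> f v - f u < - r * (v - u)) \<and>
                                   (\<exists>u v. chord_near x d u v \<and> f v - f u > r * (v - u))}"
    (is "negligible ?S")
  unfolding negligible_outer_le
proof (intro allI impI)
  fix e :: real assume e: "e > 0"
  let ?V = "var_sum f ` {D. D division_of {a..b}}"
  have bdd: "bdd_above ?V" using B by (auto simp: bdd_above_def)
  have ne: "?V \<noteq> {}" using elementary_interval[of a b] by auto
  \<comment> \<open>Chords against the trend, of total length \<open>l\<close>, will raise the
    variation by \<open>2 * r * l\<close>. A slack of \<open>e * r\<close> below the supremum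
    therefore forces \<open>l\<close> to be at most \<open>e / 2\<close>.\<close>
  obtain D1 where D1: "D1 division_of {a..b}" "var_sum f D1 > Sup ?V - e * r"
    using less_cSup_iff[OF ne bdd, of "Sup ?V - e * r"] e r by auto
  \<comment> \<open>Degenerate cells contribute no variation; after dropping them every cell has
    distinct ends.\<close>
  define D where "D = {K \<in> D1. measure lborel K \<noteq> 0}"
  have D: "D division_of {a..b}"
    using division_of_nontrivial[of D1 a b] D1 ab unfolding D_def by (auto simp: content_real)
  note DD = division_ofD[OF D]
  have cell: "\<exists>c d. c < d \<and> K = {c..d}" if K: "K \<in> D" for K
  proof -
    obtain c d where "K = {c..d}" using DD(4)[OF K] by auto
    then show ?thesis using K by (auto simp: D_def content_real_if split: if_splits)
  qed
  have vD: "var_sum f D > Sup ?V - e * r"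
  proof -
    have "var_sum f D1 = var_sum f D"
      unfolding var_sum_def
    proof (rule sum.mono_neutral_right)
      show "finite D1" using D1 by blast
      show "D \<subseteq> D1" by (auto simp: D_def)
      show "\<forall>K\<in>D1 - D. \<bar>f (Sup K) - f (Inf K)\<bar> = 0"
      proof
        fix K assume K: "K \<in> D1 - D"
        then obtain c d where cd: "K = {c..d}" using division_ofD(4)[OF D1(1), of K] by auto
        have "K \<noteq> {}" using division_ofD(3)[OF D1(1)] K by blast
        with K cd have "c = d" by (auto simp: D_def content_real_if split: if_splits)
        then show "\<bar>f (Sup K) - f (Inf K)\<bar> = 0" using cd by simp
      qed
    qed
    then show ?thesis using D1 by simp
  qed
  define s where "s K = (if f (Sup K) \<ge> f (Inf K) then 1 else - 1 :: real)" for K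
  \<comment> \<open>Chords inside one cell that run against the trend of that cell. A point of the
    exceptional set has arbitrarily short steep chords of both signs, so it has one of this kind
    whatever the sign \<open>s K\<close> is.\<close>
  define P where "P u v \<longleftrightarrow> (\<exists>K\<in>D. {u..v} \<subseteq> K \<and> s K * (f v - f u) \<le> - r * (v - u))" for u v
  \<comment> \<open>Away from the finitely many division points, \<open>x\<close> is interior to its
    cell, and short chords near \<open>x\<close> stay in this cell.\<close>
  define F where "F = Inf ` D \<union> Sup ` D"
  have finF: "finite F" using DD(1) by (simp add: F_def)
  have "\<exists>T. ?S - F \<subseteq> T \<and> T \<in> lmeasurable \<and> measure lebesgue T \<le> e"
  proof -
    have c1: "\<exists>u v. chord_near x d u v \<and> P u v" if x: "x \<in> ?S - F" and d: "d > 0" for x d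
    proof -
      have "x \<in> {a..b}" using x by auto
      then obtain K where K: "K \<in> D" "x \<in> K" using DD(6) by blast
      obtain p q where pq: "p < q" "K = {p..q}" using cell K by blast
      have "Inf K = p" "Sup K = q" using pq by auto
      then have "p \<in> F" "q \<in> F" using K unfolding F_def by blast+
      then have xpq: "p < x" "x < q" using x K pq by (auto simp: less_le)
      define d' where "d' = Min {d, x - p, q - x}"
      have d': "d' > 0" "d' \<le> d" "d' \<le> x - p" "d' \<le> q - x" using d xpq by (auto simp: d'_def)
      have "\<exists>u v. chord_near x d' u v \<and> s K * (f v - f u) \<le> - r * (v - u)"
      proof (cases "f (Sup K) \<ge> f (Inf K)")
        case True
        obtain u v where "chord_near x d' u v" "f v - f u < - r * (v - u)" using x d'(1) by blast
        then show ?thesis using True by (intro exI[of _ u] exI[of _ v]) (auto simp: s_def)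
      next
        case False
        obtain u v where "chord_near x d' u v" "f v - f u > r * (v - u)" using x d'(1) by blast
        then show ?thesis using False by (intro exI[of _ u] exI[of _ v]) (auto simp: s_def)
      qed
      then obtain u v where uv: "chord_near x d' u v" "s K * (f v - f u) \<le> - r * (v - u)" by blast
      then have "{u..v} \<subseteq> K" using d' pq by (auto simp: chord_near_def)
      then show ?thesis using uv K d' unfolding P_def chord_near_def
        by (meson order_less_le_trans)
    qed
    have c2: "(\<Sum>K\<in>C. measure lborel K) \<le> e"
      if C: "finite C" "C division_of \<Union>C" "\<And>K. K \<in> C \<Longrightarrow> \<exists>u v. u < v \<and> K = {u..v} \<and> P u v" for C
    proof -
      define E where "E K = {J \<in> C. J \<subseteq> K \<and> s K * (f (Sup J) - f (Inf J)) \<le> - r * measure lborel J}" for K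
      have CE: "C \<subseteq> (\<Union>K\<in>D. E K)"
      proof
        fix J assume J: "J \<in> C"
        then obtain u v where "u < v" "J = {u..v}" "P u v" using C(3) by blast
        then show "J \<in> (\<Union>K\<in>D. E K)" using J by (auto simp: P_def E_def)
      qed
      \<comment> \<open>The selected chords in \<open>K\<close> are completed to a division of
        \<open>K\<close>, again without degenerate cells as required by
        \<open>division_of_refine\<close>.\<close>
      have "\<exists>q. E K \<subseteq> q \<and> q division_of K \<and> (\<forall>J\<in>q. interior J \<noteq> {})" if K: "K \<in> D" for K
      proof -
        obtain c d where cd: "c < d" "K = {c..d}" using cell K by blast
        have "E K division_of \<Union>(E K)" using C(2) by (rule division_of_subset) (auto simp: E_def)
        moreover have "\<Union>(E K) \<subseteq> cbox c d" using cd by (auto simp: E_def)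
        ultimately obtain q where q: "E K \<subseteq> q" "q division_of cbox c d"
          by (rule partial_division_extend_interval)
        have "{J\<in>q. measure lborel J \<noteq> 0} division_of cbox c d"
          using division_of_nontrivial[OF q(2)] cd by (auto simp: content_real)
        moreover have "E K \<subseteq> {J\<in>q. measure lborel J \<noteq> 0}"
        proof
          fix J assume J: "J \<in> E K"
          then obtain u v where "u < v" "J = {u..v}" using C(3) by (force simp: E_def)
          then show "J \<in> {J\<in>q. measure lborel J \<noteq> 0}" using J q by auto
        qed
        moreover have "interior J \<noteq> {}" if J: "J \<in> {J\<in>q. measure lborel J \<noteq> 0}" for J
        proof -
          have "J \<in> q" using J by blast
          then obtain u v where "J = cbox u v" using division_ofD(4)[OF q(2)] by blast
          then show ?thesis using J by (auto simp: content_real_if split: if_splits)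
        qed
        ultimately show ?thesis using cd by (metis (no_types, lifting) box_real(2))
      qed
      then obtain q where q: "\<And>K. K \<in> D \<Longrightarrow> E K \<subseteq> q K" "\<And>K. K \<in> D \<Longrightarrow> q K division_of K"
        "\<And>K J. K \<in> D \<Longrightarrow> J \<in> q K \<Longrightarrow> interior J \<noteq> {}" by metis
      \<comment> \<open>The refinement of all cells is still a division of \<open>{a..b}\<close>, so
        its variation cannot exceed the supremum, although every cell has gained from its opposing
        chords.\<close>
      have "(\<Sum>K\<in>D. \<bar>f (Sup K) - f (Inf K)\<bar> + 2 * r * (\<Sum>J\<in>E K. measure lborel J)) \<le> (\<Sum>K\<in>D. var_sum f (q K))"
      proof (rule sum_mono)
        fix K assume K: "K \<in> D"
        obtain c d where cd: "c < d" "K = {c..d}" using cell K by blast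
        have *: "Inf K = c" "Sup K = d" using cd by auto
        show "\<bar>f (Sup K) - f (Inf K)\<bar> + 2 * r * (\<Sum>J\<in>E K. measure lborel J) \<le> var_sum f (q K)"
          unfolding *
        proof (rule var_sum_counter_slopes[where s = "s K"])
          show "q K division_of {c..d}" using q K cd by auto
          show "c \<le> d" "E K \<subseteq> q K" "\<bar>s K\<bar> = 1" "0 \<le> r" using q K cd r by (auto simp: s_def)
          show "s K * (f d - f c) \<ge> 0" using cd by (auto simp: s_def)
          show "s K * (f (Sup J) - f (Inf J)) \<le> - r * measure lborel J" if "J \<in> E K" for J
            using that by (simp add: E_def)
        qed
      qed
      also have "\<dots> = var_sum f (\<Union>(q ` D))"
        by (rule division_of_refine(2)[OF D, symmetric]) (use q in auto)
      also have "\<dots> \<le> Sup ?V"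
        by (rule cSup_upper[OF _ bdd]) (use division_of_refine(1)[OF D, of q] q in auto)
      finally have "var_sum f D + 2 * r * (\<Sum>K\<in>D. \<Sum>J\<in>E K. measure lborel J) \<le> Sup ?V"
        by (simp add: sum.distrib sum_distrib_left[symmetric] var_sum_def)
      then have "2 * r * (\<Sum>K\<in>D. \<Sum>J\<in>E K. measure lborel J) \<le> e * r" using vD by linarith
      then have "2 * (\<Sum>K\<in>D. \<Sum>J\<in>E K. measure lborel J) \<le> e" using r by (simp add: mult.commute mult.left_commute)
      moreover have "(\<Sum>K\<in>C. measure lborel K) \<le> (\<Sum>K\<in>D. \<Sum>J\<in>E K. measure lborel J)"
      proof -
        have "(\<Sum>K\<in>C. measure lborel K) \<le> (\<Sum>K\<in>(\<Union>K\<in>D. E K). measure lborel K)"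
          using CE DD(1) C(1) by (intro sum_mono2) (auto simp: E_def)
        also have "\<dots> \<le> (\<Sum>K\<in>D. \<Sum>J\<in>E K. measure lborel J)"
          using DD(1) C(1) sum_UNION_nonneg_le[of D E "measure lborel"] by (auto simp: E_def)
        finally show ?thesis .
      qed
      moreover have "(\<Sum>K\<in>C. measure lborel K) \<ge> 0" by (simp add: sum_nonneg)
      ultimately show ?thesis by linarith
    qed
    show ?thesis by (rule vitali_interval_cover[of "?S - F" P e]) (use c1 c2 in blast)+
  qed
  then obtain T where T: "?S - F \<subseteq> T" "T \<in> lmeasurable" "measure lebesgue T \<le> e" by blast
  have nF: "negligible F" using finF by (rule negligible_finite)
  have "T \<union> F \<in> lmeasurable" using T nF by (simp add: negligible_imp_measurable fmeasurable.Un)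
  moreover have "measure lebesgue (T \<union> F) \<le> e"
  proof -
    have "measure lebesgue (T \<union> F) \<le> measure lebesgue T + measure lebesgue F"
      using T nF by (intro measure_Un_le) (auto simp: negligible_imp_sets fmeasurableD)
    then show ?thesis using T nF by (simp add: negligible_imp_measure0)
  qed
  ultimately show "\<exists>T. ?S \<subseteq> T \<and> T \<in> lmeasurable \<and> measure lebesgue T \<le> e"
    using T(1) by (intro exI[of _ "T \<union> F"]) auto
qed

text \<open>Disjoint chords steeper than \<open>M\<close> carry a variation of at least
  \<open>M\<close> times their total length. As the variation is at most \<open>B\<close>, this
  length is small when \<open>M\<close> is large.\<close>

lemma negligible_unbounded_slopes:
  fixes f :: "real \<Rightarrow> real"
  assumes ab: "a < b" and B: "\<And>D. D division_of {a..b} \<Longrightarrow> var_sum f D \<le> B"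
  shows "negligible {x \<in> {a<..<b}. \<forall>M d. d > 0 \<longrightarrow> (\<exists>u v. chord_near x d u v \<and> \<bar>f v - f u\<bar> > M * (v - u))}"
    (is "negligible ?S")
  unfolding negligible_outer_le
proof (intro allI impI)
  fix e :: real assume e: "e > 0"
  obtain D0 where D0: "D0 division_of {a..b}" using elementary_interval[of a b] by auto
  have "0 \<le> var_sum f D0" by (simp add: var_sum_def sum_nonneg)
  then have B0: "B \<ge> 0" using B[OF D0] by simp
  \<comment> \<open>The summand 1 keeps \<open>M\<close> positive when \<open>B\<close> is 0; then
    \<open>M * e\<close> is at least \<open>B\<close>.\<close>
  define M where "M = (B + 1) / e"
  have M: "M > 0" using B0 e by (simp add: M_def)
  define P where "P u v \<longleftrightarrow> {u..v} \<subseteq> {a..b} \<and> \<bar>f v - f u\<bar> > M * (v - u)" for u v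
  have c1: "\<exists>u v. chord_near x d u v \<and> P u v" if x: "x \<in> ?S" and d: "d > 0" for x d
  proof -
    define d' where "d' = Min {d, x - a, b - x}"
    have d': "d' > 0" "d' \<le> d" "d' \<le> x - a" "d' \<le> b - x" using d x by (auto simp: d'_def)
    then obtain u v where uv: "chord_near x d' u v" "\<bar>f v - f u\<bar> > M * (v - u)" using x by blast
    then have "{u..v} \<subseteq> {a..b}" using d' by (auto simp: chord_near_def)
    then show ?thesis using uv d' unfolding P_def chord_near_def by (meson order_less_le_trans)
  qed
  have c2: "(\<Sum>K\<in>C. measure lborel K) \<le> e"
    if C: "finite C" "C division_of \<Union>C" "\<And>K. K \<in> C \<Longrightarrow> \<exists>u v. u < v \<and> K = {u..v} \<and> P u v" for C
  proof -
    have "\<Union>C \<subseteq> cbox a b" using C(3) unfolding P_def by fastforce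
    then obtain q where q: "C \<subseteq> q" "q division_of cbox a b"
      using partial_division_extend_interval[OF C(2)] by blast
    have "M * (\<Sum>K\<in>C. measure lborel K) \<le> var_sum f C"
      unfolding var_sum_def sum_distrib_left
    proof (rule sum_mono)
      fix K assume "K \<in> C"
      then obtain u v where "u < v" "K = {u..v}" "P u v" using C(3) by blast
      then show "M * measure lborel K \<le> \<bar>f (Sup K) - f (Inf K)\<bar>" by (simp add: P_def)
    qed
    also have "\<dots> \<le> var_sum f q" unfolding var_sum_def using q by (intro sum_mono2) auto
    also have "\<dots> \<le> B" using B q by simp
    also have "\<dots> \<le> M * e" using e by (simp add: M_def)
    finally show ?thesis using M by simp
  qed
  show "\<exists>T. ?S \<subseteq> T \<and> T \<in> lmeasurable \<and> measure lebesgue T \<le> e"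
    by (rule vitali_interval_cover[of ?S P e]) (use c1 c2 in blast)+
qed

section \<open>From tame slopes to differentiability\<close>

text \<open>\<open>L\<close> is the upper derivative, the infimum of the eventual upper bounds of
  the slopes. If \<open>q + r < L\<close>, then \<open>q + r\<close> is no such bound, so
  \<open>osc\<close> leaves only its first alternative, a lower bound \<open>q - r\<close>; this can
  be chosen arbitrarily close to \<open>L\<close>. Rational levels suffice by density and later keep
  the number of exceptional sets countable.\<close>

lemma differentiable_if_slopes_converge:
  fixes f :: "real \<Rightarrow> real"
  assumes bd: "d0 > 0" "\<And>u v. chord_near x d0 u v \<Longrightarrow> \<bar>f v - f u\<bar> \<le> M * (v - u)"
    and osc: "\<And>q r. q \<in> \<rat> \<Longrightarrow> r \<in> \<rat> \<Longrightarrow> r > 0 \<Longrightarrow> \<exists>d>0.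
       (\<forall>u v. chord_near x d u v \<longrightarrow> f v - f u \<ge> (q - r) * (v - u)) \<or>
       (\<forall>u v. chord_near x d u v \<longrightarrow> f v - f u \<le> (q + r) * (v - u))"
  shows "f differentiable (at x)"
proof -
  define A where "A = {m. \<exists>d>0. \<forall>u v. chord_near x d u v \<longrightarrow> f v - f u \<le> m * (v - u)}"
  have MA: "M \<in> A" using bd unfolding A_def by (auto simp: abs_le_iff intro!: exI[of _ d0])
  have lb: "- M \<le> m" if m: "m \<in> A" for m
  proof -
    obtain d where d: "d > 0" "\<And>u v. chord_near x d u v \<Longrightarrow> f v - f u \<le> m * (v - u)"
      using m by (auto simp: A_def)
    define h where "h = min d d0 / 2"
    have h: "h > 0" "chord_near x d x (x + h)" "chord_near x d0 x (x + h)"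
      using d(1) bd(1) by (auto simp: h_def chord_near_def min_def)
    have "- (M * h) \<le> m * h" using d(2)[OF h(2)] bd(2)[OF h(3)] by (auto simp: abs_le_iff)
    then show ?thesis using h(1) by (metis minus_mult_left mult_le_cancel_right_pos)
  qed
  have bdd: "bdd_below A" using lb by (auto simp: bdd_below_def)
  define L where "L = Inf A"
  have up: "\<exists>d>0. \<forall>u v. chord_near x d u v \<longrightarrow> f v - f u \<le> (L + e) * (v - u)" if e: "e > 0" for e
  proof -
    obtain m where m: "m \<in> A" "m < L + e"
      using cInf_lessD[of A "L + e"] MA e by (auto simp: L_def)
    then obtain d where d: "d > 0" "\<And>u v. chord_near x d u v \<Longrightarrow> f v - f u \<le> m * (v - u)"
      by (auto simp: A_def)
    have "f v - f u \<le> (L + e) * (v - u)" if "chord_near x d u v" for u v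
    proof -
      have "m * (v - u) \<le> (L + e) * (v - u)" using m that
        by (intro mult_right_mono) (auto simp: chord_near_def)
      then show ?thesis using d(2)[OF that] by linarith
    qed
    then show ?thesis using d(1) by blast
  qed
  have lo: "\<exists>d>0. \<forall>u v. chord_near x d u v \<longrightarrow> f v - f u \<ge> (L - e) * (v - u)" if e: "e > 0" for e
  proof -
    \<comment> \<open>The windows for \<open>q\<close> and \<open>r\<close> ensure both
      \<open>q + r < L\<close> and \<open>q - r > L - e\<close>.\<close>
    obtain q where q: "q \<in> \<rat>" "L - e * 2 / 3 < q" "q < L - e / 3"
      using Rats_dense_in_real[of "L - e * 2 / 3" "L - e / 3"] e by auto
    obtain r where r: "r \<in> \<rat>" "0 < r" "r < e / 3"
      using Rats_dense_in_real[of 0 "e / 3"] e by auto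
    obtain d where d: "d > 0" "(\<forall>u v. chord_near x d u v \<longrightarrow> f v - f u \<ge> (q - r) * (v - u)) \<or>
       (\<forall>u v. chord_near x d u v \<longrightarrow> f v - f u \<le> (q + r) * (v - u))" using osc[OF q(1) r(1,2)] by blast
    have "q + r \<notin> A"
      using cInf_lower[OF _ bdd, of "q + r"] q r e by (force simp: L_def)
    then have lo: "\<forall>u v. chord_near x d u v \<longrightarrow> f v - f u \<ge> (q - r) * (v - u)"
      using d unfolding A_def by blast
    have "f v - f u \<ge> (L - e) * (v - u)" if "chord_near x d u v" for u v
    proof -
      have "(L - e) * (v - u) \<le> (q - r) * (v - u)" using q r that
        by (intro mult_right_mono) (auto simp: chord_near_def)
      then show ?thesis using lo that by fastforce
    qed
    then show ?thesis using d(1) by blast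
  qed
  have "(f has_field_derivative L) (at x)"
    unfolding has_field_derivative_iff LIM_def
  proof (intro allI impI)
    fix e :: real assume e: "0 < e"
    then have e2: "e / 2 > 0" by simp
    obtain d1 where d1: "d1 > 0" "\<And>u v. chord_near x d1 u v \<Longrightarrow> f v - f u \<le> (L + e / 2) * (v - u)"
      using up[OF e2] by blast
    obtain d2 where d2: "d2 > 0" "\<And>u v. chord_near x d2 u v \<Longrightarrow> f v - f u \<ge> (L - e / 2) * (v - u)"
      using lo[OF e2] by blast
    show "\<exists>s>0. \<forall>y. y \<noteq> x \<and> dist y x < s \<longrightarrow> dist ((f y - f x) / (y - x)) L < e"
    proof (intro exI[of _ "min d1 d2"] conjI allI impI)
      show "min d1 d2 > 0" using d1 d2 by simp
      fix y assume y: "y \<noteq> x \<and> dist y x < min d1 d2"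
      define s where "s = (f y - f x) / (y - x)"
      have "L - e / 2 \<le> s \<and> s \<le> L + e / 2"
      proof (cases "x < y")
        case True
        then have c: "chord_near x d1 x y" "chord_near x d2 x y" using y by (auto simp: chord_near_def dist_real_def)
        have "f y - f x = s * (y - x)" using True by (simp add: s_def)
        then show ?thesis using d1(2)[OF c(1)] d2(2)[OF c(2)] True
          by (metis diff_gt_0_iff_gt mult_le_cancel_right_pos)
      next
        case False
        then have "y < x" using y by auto
        then have c: "chord_near x d1 y x" "chord_near x d2 y x" using y by (auto simp: chord_near_def dist_real_def)
        have "s = (f x - f y) / (x - y)" using minus_divide_divide[of "f x - f y" "x - y"] by (simp add: s_def)
        then have "f x - f y = s * (x - y)" using \<open>y < x\<close> by simp
        then show ?thesis using d1(2)[OF c(1)] d2(2)[OF c(2)] \<open>y < x\<close>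
          by (metis diff_gt_0_iff_gt mult_le_cancel_right_pos)
      qed
      then have "dist s L \<le> e / 2" unfolding dist_real_def by linarith
      then show "dist ((f y - f x) / (y - x)) L < e" using e by (simp add: s_def)
    qed
  qed
  then show ?thesis by (meson field_differentiable_def field_differentiable_imp_differentiable)
qed

text \<open>Subtracting \<open>q * x\<close> moves oscillation about the slope \<open>q\<close> to
  oscillation about 0, and the variation stays bounded. The sign argument thus becomes available at
  every level.\<close>

lemma var_sum_shift_le:
  assumes "D division_of {a..b}" "a \<le> b"
  shows "var_sum (\<lambda>x. f x - q * x) D \<le> var_sum f D + \<bar>q\<bar> * (b - a)"
proof -
  note D = division_ofD[OF assms(1)]
  have "var_sum (\<lambda>x. f x - q * x) D \<le> (\<Sum>K\<in>D. \<bar>f (Sup K) - f (Inf K)\<bar> + \<bar>q\<bar> * (Sup K - Inf K))"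
    unfolding var_sum_def
  proof (rule sum_mono)
    fix K assume K: "K \<in> D"
    then obtain c d where "K = {c..d}" using D(4)[of K] by auto
    moreover have "K \<noteq> {}" using D(3) K by blast
    ultimately have "Inf K \<le> Sup K" by simp
    have "\<bar>f (Sup K) - q * Sup K - (f (Inf K) - q * Inf K)\<bar> = \<bar>(f (Sup K) - f (Inf K)) - q * (Sup K - Inf K)\<bar>"
      by (simp add: algebra_simps)
    also have "\<dots> \<le> \<bar>f (Sup K) - f (Inf K)\<bar> + \<bar>q * (Sup K - Inf K)\<bar>" by (rule abs_triangle_ineq4)
    finally show "\<bar>f (Sup K) - q * Sup K - (f (Inf K) - q * Inf K)\<bar> \<le> \<bar>f (Sup K) - f (Inf K)\<bar> + \<bar>q\<bar> * (Sup K - Inf K)"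
      using \<open>Inf K \<le> Sup K\<close> by (simp add: abs_mult)
  qed
  also have "\<dots> = var_sum f D + \<bar>q\<bar> * (b - a)"
    using sum_increments_division[OF assms, of "\<lambda>x. x"]
    by (simp add: var_sum_def sum.distrib sum_distrib_left[symmetric])
  finally show ?thesis .
qed

text \<open>Outside countably many null sets, one for each rational level and margin and one for
  unbounded slopes, the slopes neither oscillate nor blow up, so they converge.\<close>

lemma bounded_variation_imp_ae_differentiable:
  fixes f :: "real \<Rightarrow> real"
  assumes ab: "a < b" and B: "\<And>D. D division_of {a..b} \<Longrightarrow> var_sum f D \<le> B"
  shows "negligible {x \<in> {a<..<b}. \<not> f differentiable (at x)}"
proof -
  define S where "S q r = {x \<in> {a<..<b}. \<forall>d>0.
      (\<exists>u v. chord_near x d u v \<and> (f v - q * v) - (f u - q * u) < - r * (v - u)) \<and>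
      (\<exists>u v. chord_near x d u v \<and> (f v - q * v) - (f u - q * u) > r * (v - u))}" for q r
  define T where "T = {x \<in> {a<..<b}. \<forall>M d. d > 0 \<longrightarrow> (\<exists>u v. chord_near x d u v \<and> \<bar>f v - f u\<bar> > M * (v - u))}"
  have nS: "negligible (S q r)" if "r > 0" for q r
  proof -
    have B': "var_sum (\<lambda>x. f x - q * x) D \<le> B + \<bar>q\<bar> * (b - a)" if D: "D division_of {a..b}" for D
      using var_sum_shift_le[OF D, of f q] B[OF D] ab by linarith
    show ?thesis unfolding S_def
      by (rule negligible_oscillating_slopes[OF ab B' that])
  qed
  have nT: "negligible T" unfolding T_def by (rule negligible_unbounded_slopes[OF ab B])
  let ?Q = "\<rat> \<times> (\<rat> \<inter> {0<..}) :: (real \<times> real) set"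
  have "negligible (\<Union>((\<lambda>(q, r). S q r) ` ?Q))"
  proof (rule negligible_countable_Union)
    show "countable ((\<lambda>(q, r). S q r) ` ?Q)" by (intro countable_image countable_SIGMA countable_Int1 countable_rat)
    show "negligible X" if "X \<in> (\<lambda>(q, r). S q r) ` ?Q" for X using that nS by auto
  qed
  then have n: "negligible (\<Union>((\<lambda>(q, r). S q r) ` ?Q) \<union> T)" using nT by simp
  show ?thesis
  proof (rule negligible_subset[OF n], rule subsetI)
    fix x assume x: "x \<in> {x \<in> {a<..<b}. \<not> f differentiable (at x)}"
    show "x \<in> \<Union>((\<lambda>(q, r). S q r) ` ?Q) \<union> T"
    proof (rule ccontr)
      assume no: "x \<notin> \<Union>((\<lambda>(q, r). S q r) ` ?Q) \<union> T"
      then obtain M d0 where bd: "d0 > 0" "\<And>u v. chord_near x d0 u v \<Longrightarrow> \<bar>f v - f u\<bar> \<le> M * (v - u)"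
        using x unfolding T_def by (fastforce simp: not_less)
      have "f differentiable (at x)"
      proof (rule differentiable_if_slopes_converge[OF bd])
        fix q r :: real assume qr: "q \<in> \<rat>" "r \<in> \<rat>" "r > 0"
        then have "x \<notin> S q r" using no by auto
        then obtain d where d: "d > 0"
          "(\<forall>u v. chord_near x d u v \<longrightarrow> (f v - q * v) - (f u - q * u) \<ge> - r * (v - u)) \<or>
           (\<forall>u v. chord_near x d u v \<longrightarrow> (f v - q * v) - (f u - q * u) \<le> r * (v - u))"
          using x unfolding S_def by (auto simp: not_less)
        then show "\<exists>d>0. (\<forall>u v. chord_near x d u v \<longrightarrow> f v - f u \<ge> (q - r) * (v - u)) \<or>
            (\<forall>u v. chord_near x d u v \<longrightarrow> f v - f u \<le> (q + r) * (v - u))"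
          by (intro exI[of _ d]) (simp add: algebra_simps)
      qed
      then show False using x by simp
    qed
  qed
qed

text \<open>On an interval shorter than \<delta>, absolute continuity for the bound 1 is itself a
  variation bound. Countably many such intervals with rational ends cover the open interval.\<close>

lemma abs_continuous_on_imp_ae_differentiable_real:
  fixes f :: "real \<Rightarrow> real"
  assumes ac: "abs_continuous_on {a..b} (\<lambda>x. of_real (f x))"
  shows "negligible {x \<in> {a<..<b}. \<not> f differentiable (at x)}"
proof -
  obtain \<delta> where \<delta>: "\<delta> > 0" "\<And>D T. D division_of T \<Longrightarrow> T \<subseteq> {a..b} \<Longrightarrow> (\<Sum>K\<in>D. measure lborel K) < \<delta> \<Longrightarrow>
        (\<Sum>K\<in>D. norm (complex_of_real (f (Sup K)) - of_real (f (Inf K)))) < 1"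
    using ac unfolding abs_continuous_on_def by (meson zero_less_one)
  define N where "N c d = {x \<in> {c<..<d}. \<not> f differentiable (at x)}" for c d
  define Q where "Q = {(c, d). c \<in> \<rat> \<and> d \<in> \<rat> \<and> a \<le> c \<and> c < d \<and> d \<le> b \<and> d - c < \<delta>}"
  have nN: "negligible (N c d)" if cd: "(c, d) \<in> Q" for c d
    unfolding N_def
  proof (rule bounded_variation_imp_ae_differentiable[where B = 1])
    show "c < d" using cd by (simp add: Q_def)
    show "var_sum f D \<le> 1" if D: "D division_of {c..d}" for D
    proof -
      have "(\<Sum>K\<in>D. measure lborel K) = d - c"
        using additive_content_division[of D c d] D cd by (simp add: Q_def)
      then have "(\<Sum>K\<in>D. norm (complex_of_real (f (Sup K)) - of_real (f (Inf K)))) < 1"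
        using \<delta>(2)[OF D] cd by (auto simp: Q_def)
      moreover have "norm (complex_of_real x - of_real y) = \<bar>x - y\<bar>" for x y
        by (metis norm_of_real of_real_diff)
      ultimately show ?thesis by (simp add: var_sum_def)
    qed
  qed
  have "negligible (\<Union>((\<lambda>(c, d). N c d) ` Q))"
  proof (rule negligible_countable_Union)
    have "countable (\<rat> \<times> \<rat> :: (real \<times> real) set)" by (intro countable_SIGMA countable_rat)
    then have "countable Q" by (rule countable_subset[rotated]) (auto simp: Q_def)
    then show "countable ((\<lambda>(c, d). N c d) ` Q)" by (rule countable_image)
    show "negligible X" if "X \<in> (\<lambda>(c, d). N c d) ` Q" for X using that nN by auto
  qed
  then show ?thesis
  proof (rule negligible_subset, intro subsetI)
    fix x assume x: "x \<in> {x \<in> {a<..<b}. \<not> f differentiable (at x)}"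
    obtain c where c: "c \<in> \<rat>" "max a (x - \<delta> / 2) < c" "c < x"
      using Rats_dense_in_real[of "max a (x - \<delta> / 2)" x] x \<delta>(1) by auto
    obtain d where d: "d \<in> \<rat>" "x < d" "d < min b (x + \<delta> / 2)"
      using Rats_dense_in_real[of x "min b (x + \<delta> / 2)"] x \<delta>(1) by auto
    have "(c, d) \<in> Q" "x \<in> N c d" using c d x by (auto simp: Q_def N_def)
    then show "x \<in> \<Union>((\<lambda>(c, d). N c d) ` Q)" by blast
  qed
qed

section \<open>Integrating the almost everywhere derivative\<close>

text \<open>The common source of the closure properties: sums, products, real and imaginary parts,
  and Lipschitz functions all have increments dominated in this way.\<close>

lemma abs_continuous_on_dominated:
  assumes f: "abs_continuous_on S f" and g: "abs_continuous_on S g" and nn: "M \<ge> 0" "L \<ge> 0"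
    and le: "\<And>x y. x \<in> S \<Longrightarrow> y \<in> S \<Longrightarrow> norm (h x - h y) \<le> M * norm (f x - f y) + L * norm (g x - g y)"
  shows "abs_continuous_on S h"
  unfolding abs_continuous_on_def
proof (intro allI impI)
  fix e :: real assume e: "e > 0"
  define e1 where "e1 = e / (2 * (M + L + 1))"
  have e1: "e1 > 0" "(M + L) * e1 < e"
  proof -
    have "e * (M + L) < e * (2 * (M + L + 1))" using e nn by (intro mult_strict_left_mono) auto
    then show "(M + L) * e1 < e" using nn by (simp add: e1_def pos_divide_less_eq mult.commute)
    show "e1 > 0" using e nn by (simp add: e1_def)
  qed
  obtain d1 where d1: "d1 > 0" "\<And>D T. D division_of T \<Longrightarrow> T \<subseteq> S \<Longrightarrow> (\<Sum>K\<in>D. measure lborel K) < d1 \<Longrightarrow>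
        (\<Sum>K\<in>D. norm (f (Sup K) - f (Inf K))) < e1"
    using f e1(1) unfolding abs_continuous_on_def by meson
  obtain d2 where d2: "d2 > 0" "\<And>D T. D division_of T \<Longrightarrow> T \<subseteq> S \<Longrightarrow> (\<Sum>K\<in>D. measure lborel K) < d2 \<Longrightarrow>
        (\<Sum>K\<in>D. norm (g (Sup K) - g (Inf K))) < e1"
    using g e1(1) unfolding abs_continuous_on_def by meson
  show "\<exists>d>0. \<forall>D T. D division_of T \<longrightarrow> T \<subseteq> S \<longrightarrow> (\<Sum>K\<in>D. measure lborel K) < d \<longrightarrow>
        (\<Sum>K\<in>D. norm (h (Sup K) - h (Inf K))) < e"
  proof (intro exI[of _ "min d1 d2"] conjI allI impI)
    fix D T assume D: "D division_of T" "T \<subseteq> S" "(\<Sum>K\<in>D. measure lborel K) < min d1 d2"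
    have "(\<Sum>K\<in>D. norm (h (Sup K) - h (Inf K)))
        \<le> (\<Sum>K\<in>D. M * norm (f (Sup K) - f (Inf K)) + L * norm (g (Sup K) - g (Inf K)))"
    proof (rule sum_mono)
      fix K assume K: "K \<in> D"
      then obtain c d where "K = {c..d}" using division_ofD(4)[OF D(1), of K] by auto
      moreover have "K \<noteq> {}" "K \<subseteq> S" using division_ofD(2,3)[OF D(1) K] D(2) by auto
      ultimately have "Sup K \<in> S" "Inf K \<in> S" by auto
      then show "norm (h (Sup K) - h (Inf K)) \<le> M * norm (f (Sup K) - f (Inf K)) + L * norm (g (Sup K) - g (Inf K))"
        by (rule le)
    qed
    also have "\<dots> = M * (\<Sum>K\<in>D. norm (f (Sup K) - f (Inf K))) + L * (\<Sum>K\<in>D. norm (g (Sup K) - g (Inf K)))"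
      by (simp add: sum.distrib sum_distrib_left)
    also have "\<dots> \<le> M * e1 + L * e1"
      using d1(2)[OF D(1,2)] d2(2)[OF D(1,2)] D(3) nn by (intro add_mono mult_left_mono) auto
    also have "\<dots> < e" using e1(2) by (simp add: distrib_right)
    finally show "(\<Sum>K\<in>D. norm (h (Sup K) - h (Inf K))) < e" .
  qed (use d1 d2 in auto)
qed

lemma abs_continuous_on_imp_ae_differentiable:
  assumes ac: "abs_continuous_on {a..b} f"
  shows "negligible {x \<in> {a<..<b}. \<not> f differentiable (at x)}"
proof -
  have "abs_continuous_on {a..b} (\<lambda>x. of_real (Re (f x)))"
    using abs_Re_le_cmod by (intro abs_continuous_on_dominated[OF ac ac, where M = 1 and L = 0])
      (simp_all flip: of_real_diff minus_complex.sel)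
  moreover have "abs_continuous_on {a..b} (\<lambda>x. of_real (Im (f x)))"
    using abs_Im_le_cmod by (intro abs_continuous_on_dominated[OF ac ac, where M = 1 and L = 0])
      (simp_all flip: of_real_diff minus_complex.sel)
  ultimately have "negligible ({x \<in> {a<..<b}. \<not> (\<lambda>x. Re (f x)) differentiable (at x)}
      \<union> {x \<in> {a<..<b}. \<not> (\<lambda>x. Im (f x)) differentiable (at x)})"
    using abs_continuous_on_imp_ae_differentiable_real[of a b "\<lambda>x. Re (f x)"]
      abs_continuous_on_imp_ae_differentiable_real[of a b "\<lambda>x. Im (f x)"] by (intro negligible_Un) simp_all
  then show ?thesis
  proof (rule negligible_subset, intro subsetI)
    fix x assume x: "x \<in> {x \<in> {a<..<b}. \<not> f differentiable (at x)}"
    have "f differentiable (at x)"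
      if R: "(\<lambda>x. Re (f x)) differentiable (at x)" and I: "(\<lambda>x. Im (f x)) differentiable (at x)"
      using R I by (subst differentiable_componentwise_within) (auto simp: Basis_complex_def inner_complex_def)
    then show "x \<in> {x \<in> {a<..<b}. \<not> (\<lambda>x. Re (f x)) differentiable (at x)}
      \<union> {x \<in> {a<..<b}. \<not> (\<lambda>x. Im (f x)) differentiable (at x)}" using x by blast
  qed
qed

text \<open>The gauge is controlled by the derivative off the exceptional null set, and on the null set
  by an open neighbourhood of small measure, where absolute continuity bounds the increments.\<close>

theorem abs_continuous_on_has_integral:
  assumes ab: "a \<le> b" and ac: "abs_continuous_on {a..b} F" and N: "negligible N"
    and der: "\<And>x. x \<in> {a..b} - N \<Longrightarrow> (F has_vector_derivative f x) (at x)"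
  shows "(f has_integral F b - F a) {a..b}"
proof -
  \<comment> \<open>With the value 0 on \<open>N\<close>, a cell tagged in \<open>N\<close>
    contributes only its increment of \<open>F\<close>. The change on a null set is undone at the
    end.\<close>
  define g where "g x = (if x \<in> N then 0 else f x)" for x
  have "(g has_integral F b - F a) {a..b}"
    unfolding has_integral_real
  proof (intro allI impI)
    fix e :: real assume e: "e > 0"
    \<comment> \<open>The summand 1 keeps the denominator positive when
      \<open>a = b\<close>.\<close>
    define e1 where "e1 = e / (2 * (b - a + 1))"
    have e1: "e1 > 0" "e1 * (b - a) < e / 2" 
      using e ab by (auto simp: e1_def field_simps)
    obtain \<delta> where \<delta>: "\<delta> > 0" "\<And>D T. D division_of T \<Longrightarrow> T \<subseteq> {a..b} \<Longrightarrow> (\<Sum>K\<in>D. measure lborel K) < \<delta> \<Longrightarrow>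
        (\<Sum>K\<in>D. norm (F (Sup K) - F (Inf K))) < e / 2"
      using ac e unfolding abs_continuous_on_def by (meson half_gt_zero)
    have Nl: "N \<in> sets lebesgue" using N by (rule negligible_imp_sets)
    obtain U where U: "open U" "N \<subseteq> U" "U - N \<in> lmeasurable" "emeasure lebesgue (U - N) < ennreal \<delta>"
      using sets_lebesgue_outer_open[OF Nl \<delta>(1)] by metis
    have Um: "U \<in> lmeasurable" "measure lebesgue U < \<delta>"
    proof -
      have eq: "U = (U - N) \<union> N" using U(2) by blast
      have Nm: "N \<in> lmeasurable" "measure lebesgue N = 0" using N by (auto simp: negligible_imp_measurable negligible_imp_measure0)
      show "U \<in> lmeasurable" using U(3) Nm eq by (metis fmeasurable.Un)
      have "measure lebesgue (U - N) < \<delta>" using U(3,4) \<delta>(1)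
        by (metis emeasure_eq_measure2 ennreal_less_iff measure_nonneg)
      moreover have "measure lebesgue U \<le> measure lebesgue (U - N) + measure lebesgue N"
        using measure_Un_le[of "U - N" lebesgue N] U(3) Nl eq by (metis fmeasurableD)
      ultimately show "measure lebesgue U < \<delta>" using Nm by simp
    qed
    have "\<exists>d>0. (x \<in> N \<longrightarrow> ball x d \<subseteq> U) \<and> (x \<in> {a..b} - N \<longrightarrow>
        (\<forall>y. \<bar>y - x\<bar> < d \<longrightarrow> norm (F y - F x - (y - x) *\<^sub>R f x) \<le> e1 * \<bar>y - x\<bar>))" for x
    proof (cases "x \<in> N")
      case True
      then show ?thesis using U(1,2) by (meson DiffD2 openE subsetD)
    next
      case False
      show ?thesis
      proof (cases "x \<in> {a..b}")
        case True
        then have "(F has_derivative (\<lambda>h. h *\<^sub>R f x)) (at x)"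
          using der[of x] False by (simp add: has_vector_derivative_def)
        then show ?thesis using e1(1) False unfolding has_derivative_at_alt
          by (metis real_norm_def)
      qed (use False in \<open>auto intro!: exI[of _ 1]\<close>)
    qed
    then obtain d where d: "\<And>x. d x > 0" "\<And>x. x \<in> N \<Longrightarrow> ball x (d x) \<subseteq> U"
      "\<And>x y. x \<in> {a..b} - N \<Longrightarrow> \<bar>y - x\<bar> < d x \<Longrightarrow> norm (F y - F x - (y - x) *\<^sub>R f x) \<le> e1 * \<bar>y - x\<bar>"
      by metis
    have "norm ((\<Sum>(x, K)\<in>p. measure lborel K *\<^sub>R g x) - (F b - F a)) < e"
      if p: "p tagged_division_of {a..b}" "(\<lambda>x. ball x (d x)) fine p" for p
    proof -
      note P = tagged_division_ofD[OF p(1)]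
      define p1 where "p1 = {z\<in>p. fst z \<in> N}"
      have finp: "finite p" "p1 \<subseteq> p" "finite p1" using P(1) by (auto simp: p1_def)
      have cell: "\<exists>u v. u \<le> x \<and> x \<le> v \<and> K = {u..v} \<and> a \<le> u \<and> v \<le> b \<and> {u..v} \<subseteq> ball x (d x)" if xK: "(x, K) \<in> p" for x K
      proof -
        obtain u v where "K = {u..v}" using P(4)[OF xK] by auto
        then show ?thesis using P(2,3)[OF xK] fineD[OF p(2) xK] by auto
      qed
      have eq: "(\<Sum>(x, K)\<in>p. measure lborel K *\<^sub>R g x) - (F b - F a) =
           (\<Sum>(x, K)\<in>p. measure lborel K *\<^sub>R g x - (F (Sup K) - F (Inf K)))"
        using additive_tagged_division_1[OF ab p(1), of F] by (simp add: sum_subtractf case_prod_unfold)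
      also have "norm \<dots> \<le> (\<Sum>z\<in>p. norm (case z of (x, K) \<Rightarrow> measure lborel K *\<^sub>R g x - (F (Sup K) - F (Inf K))))"
        by (rule norm_sum)
      also have "\<dots> = (\<Sum>z\<in>p - p1. norm (case z of (x, K) \<Rightarrow> measure lborel K *\<^sub>R g x - (F (Sup K) - F (Inf K))))
         + (\<Sum>z\<in>p1. norm (case z of (x, K) \<Rightarrow> measure lborel K *\<^sub>R g x - (F (Sup K) - F (Inf K))))"
        using finp by (simp add: sum.subset_diff)
      also have "(\<Sum>z\<in>p - p1. norm (case z of (x, K) \<Rightarrow> measure lborel K *\<^sub>R g x - (F (Sup K) - F (Inf K))))
         \<le> (\<Sum>z\<in>p - p1. e1 * measure lborel (snd z))"
      proof (rule sum_mono)
        fix z assume z: "z \<in> p - p1"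
        obtain x K where xK: "z = (x, K)" by (cases z)
        have xp: "(x, K) \<in> p" and xN: "x \<notin> N" using z xK by (auto simp: p1_def)
        obtain u v where uv: "u \<le> x" "x \<le> v" "K = {u..v}" "a \<le> u" "v \<le> b" "{u..v} \<subseteq> ball x (d x)"
          using cell[OF xp] by blast
        have xab: "x \<in> {a..b} - N" using uv xN by auto
        have ub: "\<bar>u - x\<bar> < d x" "\<bar>v - x\<bar> < d x"
          using subsetD[OF uv(6), of u] subsetD[OF uv(6), of v] uv(1,2) by (auto simp: dist_real_def abs_minus_commute)
        have u: "norm (F u - F x - (u - x) *\<^sub>R f x) \<le> e1 * (x - u)"
          using d(3)[OF xab ub(1)] uv(1) by (simp add: abs_if split: if_splits)
        have v: "norm (F v - F x - (v - x) *\<^sub>R f x) \<le> e1 * (v - x)"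
          using d(3)[OF xab ub(2)] uv(2) by (simp add: abs_if split: if_splits)
        \<comment> \<open>The tag splits its cell into two pieces, and the linear approximation at
          the tag is used on each.\<close>
        have "measure lborel K *\<^sub>R g x - (F (Sup K) - F (Inf K)) =
              (F u - F x - (u - x) *\<^sub>R f x) - (F v - F x - (v - x) *\<^sub>R f x)"
          using uv xN by (simp add: g_def algebra_simps)
        then have "norm (measure lborel K *\<^sub>R g x - (F (Sup K) - F (Inf K))) \<le> e1 * (x - u) + e1 * (v - x)"
          using norm_triangle_le_diff[OF add_mono[OF u v]] by simp
        also have "\<dots> = e1 * measure lborel K" using uv by (simp add: algebra_simps)
        finally show "norm (case z of (x, K) \<Rightarrow> measure lborel K *\<^sub>R g x - (F (Sup K) - F (Inf K))) \<le> e1 * measure lborel (snd z)"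
          by (simp add: xK)
      qed
      also have "(\<Sum>z\<in>p - p1. e1 * measure lborel (snd z)) \<le> (\<Sum>z\<in>p. e1 * measure lborel (snd z))"
        using finp e1 by (intro sum_mono2) auto
      also have "\<dots> = e1 * (b - a)"
        using additive_content_tagged_division[of p a b] p(1) ab
        by (simp add: sum_distrib_left[symmetric] case_prod_unfold)
      also have "(\<Sum>z\<in>p1. norm (case z of (x, K) \<Rightarrow> measure lborel K *\<^sub>R g x - (F (Sup K) - F (Inf K)))) < e / 2"
      proof -
        \<comment> \<open>The cells tagged in \<open>N\<close> divide a subset of \<open>U\<close>.
          Their total length is below \<delta>, so absolute continuity controls the sum of their
          increments.\<close>
        have td: "p1 tagged_division_of \<Union>(snd ` p1)"
          using p(1) finp(2) tagged_partial_division_of_Union_self tagged_partial_division_subset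
          by (metis tagged_division_of_def)
        note dv = division_of_tagged_division[OF td]
        have "(\<Sum>z\<in>p1. norm (case z of (x, K) \<Rightarrow> measure lborel K *\<^sub>R g x - (F (Sup K) - F (Inf K)))) =
            (\<Sum>(x, K)\<in>p1. norm (F (Sup K) - F (Inf K)))"
          by (intro sum.cong) (auto simp: p1_def g_def norm_minus_commute)
        \<comment> \<open>Different tags may share a degenerate cell, so forgetting the tags
          requires a summand that vanishes on all degenerate boxes. For one-point cells it does; the
          empty set, whose \<open>Sup\<close> and \<open>Inf\<close> are meaningless, needs the case
          distinction.\<close>
        also have "\<dots> = (\<Sum>(x, K)\<in>p1. if K = {} then 0 else norm (F (Sup K) - F (Inf K)))"
          by (intro sum.cong) (auto dest: tagged_division_ofD(2)[OF td])
        also have "\<dots> = (\<Sum>K\<in>snd ` p1. if K = {} then 0 else norm (F (Sup K) - F (Inf K)))"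
          by (rule sum.over_tagged_division_lemma[OF td]) auto
        also have "\<dots> = (\<Sum>K\<in>snd ` p1. norm (F (Sup K) - F (Inf K)))"
          using division_ofD(3)[OF dv] by (intro sum.cong) auto
        also have "\<dots> < e / 2"
        proof (rule \<delta>(2)[OF dv])
          show "\<Union>(snd ` p1) \<subseteq> {a..b}" using cell finp(2) by fastforce
          have sub: "\<Union>(snd ` p1) \<subseteq> U"
          proof
            fix y assume "y \<in> \<Union>(snd ` p1)"
            then obtain x K where xK: "(x, K) \<in> p1" "y \<in> K" by auto
            then have "y \<in> ball x (d x)" using fineD[OF p(2)] finp(2) by blast
            then show "y \<in> U" using d(2)[of x] xK by (auto simp: p1_def)
          qed
          have "measure lborel K = measure lebesgue K" if "K \<in> snd ` p1" for K
            using division_ofD(4)[OF dv that] by auto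
          then have "(\<Sum>K\<in>snd ` p1. measure lborel K) = measure lebesgue (\<Union>(snd ` p1))"
            using content_division[OF dv] by simp
          also have "\<dots> \<le> measure lebesgue U"
            using sub Um(1) dv by (intro measure_mono_fmeasurable) (auto simp: fmeasurableD lmeasurable_division)
          finally show "(\<Sum>K\<in>snd ` p1. measure lborel K) < \<delta>" using Um(2) by simp
        qed
        finally show ?thesis .
      qed
      finally show ?thesis using e1(2) by simp
    qed
    moreover have "gauge (\<lambda>x. ball x (d x))" using d(1) by (simp add: gauge_ball_dependent)
    ultimately show "\<exists>\<gamma>. gauge \<gamma> \<and> (\<forall>p. p tagged_division_of {a..b} \<and> \<gamma> fine p \<longrightarrow>
        norm ((\<Sum>(x, K)\<in>p. measure lborel K *\<^sub>R g x) - (F b - F a)) < e)"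
      by blast
  qed
  then show ?thesis by (rule has_integral_spike[OF N, rotated]) (auto simp: g_def)
qed

section \<open>Closure properties of absolute continuity\<close>

text \<open>Together with \<open>abs_continuous_on_dominated\<close> this makes every Lipschitz
  function absolutely continuous.\<close>

lemma abs_continuous_on_of_real: "abs_continuous_on S of_real"
  unfolding abs_continuous_on_def
proof (intro allI impI)
  fix e :: real assume e: "e > 0"
  show "\<exists>d>0. \<forall>D T. D division_of T \<longrightarrow> T \<subseteq> S \<longrightarrow> (\<Sum>K\<in>D. measure lborel K) < d \<longrightarrow>
        (\<Sum>K\<in>D. norm (complex_of_real (Sup K) - of_real (Inf K))) < e"
  proof (intro exI[of _ e] conjI allI impI)
    fix D :: "real set set" and T assume D: "D division_of T" "(\<Sum>K\<in>D. measure lborel K) < e"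
    have "(\<Sum>K\<in>D. norm (complex_of_real (Sup K) - of_real (Inf K))) = (\<Sum>K\<in>D. measure lborel K)"
    proof (rule sum.cong)
      fix K assume K: "K \<in> D"
      then obtain c d where "K = {c..d}" using division_ofD(4)[OF D(1), of K] by auto
      moreover have "K \<noteq> {}" using division_ofD(3)[OF D(1) K] by auto
      ultimately have *: "Sup K = d" "Inf K = c" "measure lborel K = d - c" "c \<le> d" by auto
      show "norm (complex_of_real (Sup K) - of_real (Inf K)) = measure lborel K"
        using *(4) unfolding *(1-3) of_real_diff[symmetric] norm_of_real by simp
    qed simp
    then show "(\<Sum>K\<in>D. norm (complex_of_real (Sup K) - of_real (Inf K))) < e" using D by simp
  qed (rule e)
qed

lemma abs_continuous_on_imp_continuous_on:
  assumes "abs_continuous_on {a..b} f"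
  shows "continuous_on {a..b} f"
  unfolding continuous_on_iff
proof (intro ballI allI impI)
  fix x e :: real assume x: "x \<in> {a..b}" and e: "e > 0"
  obtain d where d: "d > 0" "\<And>D T. D division_of T \<Longrightarrow> T \<subseteq> {a..b} \<Longrightarrow> (\<Sum>K\<in>D. measure lborel K) < d \<Longrightarrow>
        (\<Sum>K\<in>D. norm (f (Sup K) - f (Inf K))) < e"
    using assms e unfolding abs_continuous_on_def by meson
  have *: "norm (f v - f u) < e" if "u \<le> v" "u \<in> {a..b}" "v \<in> {a..b}" "v - u < d" for u v
    using d(2)[of "{{u..v}}" "{u..v}"] that division_of_self[of u v] by auto
  show "\<exists>d>0. \<forall>y\<in>{a..b}. dist y x < d \<longrightarrow> dist (f y) (f x) < e"
  proof (intro exI[of _ d] conjI ballI impI)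
    fix y assume "y \<in> {a..b}" "dist y x < d"
    then show "dist (f y) (f x) < e"
      using *[of x y] *[of y x] x by (cases "x \<le> y") (auto simp: dist_norm norm_minus_commute)
  qed (rule d(1))
qed

lemma abs_continuous_on_imp_bounded:
  assumes "abs_continuous_on {a..b} f"
  obtains M where "M \<ge> 0" "\<And>x. x \<in> {a..b} \<Longrightarrow> norm (f x) \<le> M"
proof -
  have "bounded (f ` {a..b})"
    using abs_continuous_on_imp_continuous_on[OF assms] by (intro compact_imp_bounded compact_continuous_image) auto
  then obtain M where "\<And>x. x \<in> {a..b} \<Longrightarrow> norm (f x) \<le> M" unfolding bounded_iff by blast
  then show thesis by (intro that[of "max M 0"]) (auto simp: le_max_iff_disj)
qed

lemma abs_continuous_on_add:
  assumes "abs_continuous_on S f" "abs_continuous_on S g"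
  shows "abs_continuous_on S (\<lambda>x. f x + g x)"
  by (rule abs_continuous_on_dominated[OF assms, where M = 1 and L = 1])
     (use norm_diff_triangle_ineq in \<open>auto simp: algebra_simps\<close>)

lemma abs_continuous_on_mult:
  assumes f: "abs_continuous_on {a..b} f" and g: "abs_continuous_on {a..b} g"
  shows "abs_continuous_on {a..b} (\<lambda>x. f x * g x)"
proof -
  obtain M where M: "M \<ge> 0" "\<And>x. x \<in> {a..b} \<Longrightarrow> norm (f x) \<le> M"
    using abs_continuous_on_imp_bounded[OF f] by blast
  obtain L where L: "L \<ge> 0" "\<And>x. x \<in> {a..b} \<Longrightarrow> norm (g x) \<le> L"
    using abs_continuous_on_imp_bounded[OF g] by blast
  show ?thesis
  proof (rule abs_continuous_on_dominated[OF f g L(1) M(1)])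
    fix x y assume xy: "x \<in> {a..b}" "y \<in> {a..b}"
    have "f x * g x - f y * g y = g x * (f x - f y) + f y * (g x - g y)" by (simp add: algebra_simps)
    also have "norm \<dots> \<le> norm (g x) * norm (f x - f y) + norm (f y) * norm (g x - g y)"
      by (metis norm_mult norm_triangle_ineq)
    also have "\<dots> \<le> L * norm (f x - f y) + M * norm (g x - g y)"
      using xy M L by (intro add_mono mult_right_mono) auto
    finally show "norm (f x * g x - f y * g y) \<le> L * norm (f x - f y) + M * norm (g x - g y)" .
  qed
qed

lemma abs_continuous_on_cong:
  assumes "abs_continuous_on S f" "\<And>x. x \<in> S \<Longrightarrow> g x = f x"
  shows "abs_continuous_on S g"
  by (rule abs_continuous_on_dominated[OF assms(1) assms(1), where M = 1 and L = 0]) (simp_all add: assms(2))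

lemma AC_loc_cong:
  assumes "AC_loc f" "\<And>x. x \<in> {-1<..<1} \<Longrightarrow> g x = f x"
  shows "AC_loc g"
  unfolding AC_loc_def
proof (intro allI impI)
  fix a b :: real assume ab: "-1 < a" "a < b" "b < 1"
  then have "abs_continuous_on {a..b} f" using assms(1) by (simp add: AC_loc_def)
  then show "abs_continuous_on {a..b} g"
    by (rule abs_continuous_on_cong) (use ab in \<open>auto intro: assms(2)\<close>)
qed

lemma AC_loc_add: "AC_loc f \<Longrightarrow> AC_loc g \<Longrightarrow> AC_loc (\<lambda>x. f x + g x)"
  by (simp add: AC_loc_def abs_continuous_on_add)

lemma AC_loc_mult: "AC_loc f \<Longrightarrow> AC_loc g \<Longrightarrow> AC_loc (\<lambda>x. f x * g x)"
  by (simp add: AC_loc_def abs_continuous_on_mult)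

subsection \<open>Functions with weighted derivative bounds\<close>

lemma nderiv_0 [simp]: "nderiv 0 f = f"
  by (simp add: nderiv_def)

definition vderiv :: "(real \<Rightarrow> complex) \<Rightarrow> real \<Rightarrow> complex" where
  "vderiv f x = vector_derivative f (at x)"

lemma nderiv_Suc_0: "nderiv (Suc 0) f = vderiv f"
  by (simp add: nderiv_def vderiv_def fun_eq_iff)

lemma nderiv_add: "nderiv (i + j) f = nderiv i (nderiv j f)"
  by (simp add: nderiv_def funpow_add)

text \<open>The recursive predicates \<open>wbounded\<close> and \<open>AC_diff\<close> peel off the
  innermost derivative; this orientation matches them.\<close>

lemma nderiv_Suc_right: "nderiv (Suc k) f = nderiv k (vderiv f)"
  using nderiv_add[of k 1 f] by (simp add: nderiv_Suc_0)

text \<open>Both functions admit the same derivatives at \<open>x\<close>, so the choice inside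
  \<open>vector_derivative\<close> returns the same value even where no derivative exists.\<close>

lemma vector_derivative_cong_open:
  assumes "open S" "x \<in> S" "\<And>y. y \<in> S \<Longrightarrow> f y = g y"
  shows "vector_derivative f (at x) = vector_derivative g (at x)"
proof -
  have "(f has_vector_derivative d) (at x) = (g has_vector_derivative d) (at x)" for d
    using has_vector_derivative_transform_within_open[OF _ assms(1,2)] assms(3) by metis
  then show ?thesis by (simp add: vector_derivative_def)
qed

lemma differentiable_cong_open:
  assumes "open S" "x \<in> S" "\<And>y. y \<in> S \<Longrightarrow> f y = g y" "f differentiable (at x)"
  shows "g differentiable (at x)"
  using assms unfolding differentiable_def by (metis has_derivative_transform_within_open)

lemma has_vector_derivative_vderiv:
  "f differentiable (at x) \<Longrightarrow> (f has_vector_derivative vderiv f x) (at x)"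
  by (simp add: vderiv_def vector_derivative_works)

lemma vderiv_eqI: "(f has_vector_derivative d) (at x) \<Longrightarrow> vderiv f x = d"
  by (simp add: vderiv_def vector_derivative_at)

section \<open>Weights and the classes of functions bounded by them\<close>

lemma jacobi_weight_pos: "x \<in> {-1<..<1} \<Longrightarrow> jacobi_weight a b x > 0"
  by (simp add: jacobi_weight_def)

lemma jacobi_weight_nonneg [simp]: "jacobi_weight a b x \<ge> 0"
  by (simp add: jacobi_weight_def)

lemma jacobi_weight_mult:
  "x \<in> {-1<..<1} \<Longrightarrow> jacobi_weight a b x * jacobi_weight c d x = jacobi_weight (a + c) (b + d) x"
  by (simp add: jacobi_weight_def powr_add)

lemma jacobi_weight_0 [simp]: "x \<in> {-1<..<1} \<Longrightarrow> jacobi_weight 0 0 x = 1"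
  by (simp add: jacobi_weight_def)

lemma jacobi_weight_le:
  assumes "x \<in> {-1<..<1}" "a \<ge> 0" "b \<ge> 0"
  shows "jacobi_weight a b x \<le> 2 powr a * 2 powr b"
  unfolding jacobi_weight_def using assms by (intro mult_mono powr_mono2) auto

lemma jacobi_weight_mono:
  assumes "x \<in> {-1<..<1}" "a' \<le> a" "b' \<le> b"
  shows "jacobi_weight a b x \<le> 2 powr (a - a') * 2 powr (b - b') * jacobi_weight a' b' x"
proof -
  have "jacobi_weight a b x = jacobi_weight (a - a') (b - b') x * jacobi_weight a' b' x"
    using jacobi_weight_mult[OF assms(1), of "a - a'" "b - b'" a' b'] by simp
  then show ?thesis using jacobi_weight_le[OF assms(1), of "a - a'" "b - b'"] assms
    by (simp add: mult_right_mono)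
qed

lemma has_real_derivative_jacobi_weight:
  assumes x: "x \<in> {-1<..<1}"
  shows "(jacobi_weight a b has_real_derivative
           b * jacobi_weight a (b - 1) x - a * jacobi_weight (a - 1) b x) (at x)"
  unfolding jacobi_weight_def using x
  by (auto intro!: derivative_eq_intros simp: powr_diff field_simps)

abbreviation cweight :: "real \<Rightarrow> real \<Rightarrow> real \<Rightarrow> complex" where
  "cweight a b x \<equiv> of_real (jacobi_weight a b x)"

lemma has_vector_derivative_cweight:
  assumes x: "x \<in> {-1<..<1}"
  shows "(cweight a b has_vector_derivative
           of_real b * cweight a (b - 1) x - of_real a * cweight (a - 1) b x) (at x)"
  using has_vector_derivative_of_real[OF has_real_derivative_jacobi_weight[OF x, of a b]] by simp

definition wbound :: "real \<Rightarrow> real \<Rightarrow> (real \<Rightarrow> complex) \<Rightarrow> bool" where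
  "wbound a b h \<longleftrightarrow> (\<exists>K. \<forall>x\<in>{-1<..<1}. norm (h x) \<le> K * jacobi_weight a b x)"

text \<open>A symbol class: each derivative may lose one power at both ends, which is no less than
  what the weights themselves lose. The derivative of order \<open>m\<close> is bounded but need not
  be continuous.\<close>

primrec wbounded :: "nat \<Rightarrow> real \<Rightarrow> real \<Rightarrow> (real \<Rightarrow> complex) \<Rightarrow> bool" where
  "wbounded 0 a b h \<longleftrightarrow> wbound a b h"
| "wbounded (Suc m) a b h \<longleftrightarrow> wbound a b h \<and> (\<forall>x\<in>{-1<..<1}. h differentiable (at x)) \<and>
     wbounded m (a - 1) (b - 1) (vderiv h)"

lemma wboundE:
  assumes "wbound a b h"
  obtains K where "K \<ge> 0" "\<And>x. x \<in> {-1<..<1} \<Longrightarrow> norm (h x) \<le> K * jacobi_weight a b x"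
proof -
  obtain K where K: "\<And>x. x \<in> {-1<..<1} \<Longrightarrow> norm (h x) \<le> K * jacobi_weight a b x"
    using assms unfolding wbound_def by blast
  have "norm (h x) \<le> \<bar>K\<bar> * jacobi_weight a b x" if "x \<in> {-1<..<1}" for x
    using K[OF that] mult_right_mono[OF abs_ge_self, of "jacobi_weight a b x" K] by simp
  then show thesis by (intro that[of "\<bar>K\<bar>"]) auto
qed

lemma wbound_le:
  assumes "wbound a b h" "\<And>x. x \<in> {-1<..<1} \<Longrightarrow> norm (k x) \<le> norm (h x)"
  shows "wbound a b k"
  using assms unfolding wbound_def by (meson order_trans)

lemma wbound_cong:
  assumes "wbound a b h" "\<And>x. x \<in> {-1<..<1} \<Longrightarrow> k x = h x"
  shows "wbound a b k"
  using assms(1) by (rule wbound_le) (simp add: assms(2))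

lemma wbound_mono:
  assumes "wbound a b h" "a' \<le> a" "b' \<le> b"
  shows "wbound a' b' h"
proof -
  obtain K where K: "K \<ge> 0" "\<And>x. x \<in> {-1<..<1} \<Longrightarrow> norm (h x) \<le> K * jacobi_weight a b x"
    using wboundE[OF assms(1)] by blast
  have "norm (h x) \<le> (K * (2 powr (a - a') * 2 powr (b - b'))) * jacobi_weight a' b' x" if x: "x \<in> {-1<..<1}" for x
    using order_trans[OF K(2)[OF x] mult_left_mono[OF jacobi_weight_mono[OF x assms(2,3)] K(1)]]
    by (simp add: mult.assoc)
  then show ?thesis unfolding wbound_def by blast
qed

lemma wbound_add:
  assumes "wbound a b f" "wbound a b g"
  shows "wbound a b (\<lambda>x. f x + g x)"
proof -
  obtain K L where "\<And>x. x \<in> {-1<..<1} \<Longrightarrow> norm (f x) \<le> K * jacobi_weight a b x"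
    "\<And>x. x \<in> {-1<..<1} \<Longrightarrow> norm (g x) \<le> L * jacobi_weight a b x"
    using assms wboundE by metis
  then have "norm (f x + g x) \<le> (K + L) * jacobi_weight a b x" if "x \<in> {-1<..<1}" for x
    using that norm_triangle_mono[of "f x" _ "g x"] by (simp add: distrib_right)
  then show ?thesis unfolding wbound_def by blast
qed

lemma wbound_mult:
  assumes "wbound a b f" "wbound c d g"
  shows "wbound (a + c) (b + d) (\<lambda>x. f x * g x)"
proof -
  obtain K where K: "K \<ge> 0" "\<And>x. x \<in> {-1<..<1} \<Longrightarrow> norm (f x) \<le> K * jacobi_weight a b x"
    using assms(1) wboundE by metis
  obtain L where L: "L \<ge> 0" "\<And>x. x \<in> {-1<..<1} \<Longrightarrow> norm (g x) \<le> L * jacobi_weight c d x"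
    using assms(2) wboundE by metis
  have "norm (f x * g x) \<le> (K * L) * jacobi_weight (a + c) (b + d) x" if x: "x \<in> {-1<..<1}" for x
  proof -
    have "norm (f x * g x) \<le> (K * jacobi_weight a b x) * (L * jacobi_weight c d x)"
      unfolding norm_mult using K L x by (intro mult_mono) auto
    then show ?thesis using jacobi_weight_mult[OF x, of a b c d] by (simp add: mult.assoc mult.left_commute)
  qed
  then show ?thesis unfolding wbound_def by blast
qed

lemma wbound_cweight: "wbound a b (cweight a b)"
  unfolding wbound_def by (intro exI[of _ 1]) simp

lemma wbound_0 [simp]: "wbound a b (\<lambda>x. 0)"
  unfolding wbound_def by (intro exI[of _ 0]) simp

lemma wbound_const: "wbound 0 0 (\<lambda>x. c)"
  unfolding wbound_def by (intro exI[of _ "norm c"]) simp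

lemma wbound_sum:
  assumes "\<And>i. i \<in> A \<Longrightarrow> wbound a b (f i)"
  shows "wbound a b (\<lambda>x. \<Sum>i\<in>A. f i x)"
  using assms by (induction A rule: infinite_finite_induct) (auto intro: wbound_add)

lemma wbounded_imp_wbound: "wbounded m a b h \<Longrightarrow> wbound a b h"
  by (cases m) auto

lemma wbounded_cong:
  assumes "wbounded m a b h" "\<And>x. x \<in> {-1<..<1} \<Longrightarrow> k x = h x"
  shows "wbounded m a b k"
  using assms
proof (induction m arbitrary: a b h k)
  case 0
  then show ?case using wbound_cong by auto
next
  case (Suc m)
  have "vderiv k x = vderiv h x" if "x \<in> {-1<..<1}" for x
    unfolding vderiv_def using vector_derivative_cong_open[OF open_greaterThanLessThan that] Suc.prems(2) by blast
  moreover have "k differentiable (at x)" if "x \<in> {-1<..<1}" for x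
    using differentiable_cong_open[OF open_greaterThanLessThan that, of h k] Suc.prems that by auto
  ultimately show ?case using Suc.IH[of "a - 1" "b - 1" "vderiv h" "vderiv k"] Suc.prems wbound_cong
    by auto
qed

lemma wbounded_mono:
  "wbounded m a b h \<Longrightarrow> a' \<le> a \<Longrightarrow> b' \<le> b \<Longrightarrow> wbounded m a' b' h"
  by (induction m arbitrary: a b a' b' h) (auto intro: wbound_mono)

lemma wbounded_le: "wbounded m a b h \<Longrightarrow> k \<le> m \<Longrightarrow> wbounded k a b h"
proof (induction m arbitrary: a b h k)
  case (Suc m)
  then show ?case by (cases k) auto
qed simp

lemma wbounded_0 [simp]: "wbounded m a b (\<lambda>x. 0)"
  by (induction m arbitrary: a b) (simp_all add: vderiv_def[abs_def])

lemma wbounded_add: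
  "wbounded m a b f \<Longrightarrow> wbounded m a b g \<Longrightarrow> wbounded m a b (\<lambda>x. f x + g x)"
proof (induction m arbitrary: a b f g)
  case 0
  then show ?case by (auto intro: wbound_add)
next
  case (Suc m)
  have fg: "f differentiable (at x)" "g differentiable (at x)" if "x \<in> {-1<..<1}" for x
    using Suc.prems that by auto
  have "vderiv (\<lambda>x. f x + g x) x = vderiv f x + vderiv g x" if "x \<in> {-1<..<1}" for x
    by (rule vderiv_eqI[OF has_vector_derivative_add[OF has_vector_derivative_vderiv[OF fg(1)[OF that]]
          has_vector_derivative_vderiv[OF fg(2)[OF that]]]])
  moreover have "wbounded m (a - 1) (b - 1) (\<lambda>x. vderiv f x + vderiv g x)"
    using Suc.IH[of "a - 1" "b - 1" "vderiv f" "vderiv g"] Suc.prems by simp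
  ultimately have "wbounded m (a - 1) (b - 1) (vderiv (\<lambda>x. f x + g x))"
    using wbounded_cong by blast
  then show ?case using Suc.prems by (auto intro: wbound_add)
qed

text \<open>In each term of the product rule exactly one factor loses a power, so the loss for the
  product is again one power.\<close>

lemma wbounded_mult:
  "wbounded m a b f \<Longrightarrow> wbounded m c d g \<Longrightarrow> wbounded m (a + c) (b + d) (\<lambda>x. f x * g x)"
proof (induction m arbitrary: a b c d f g)
  case 0
  then show ?case by (auto intro: wbound_mult)
next
  case (Suc m)
  have fg: "f differentiable (at x)" "g differentiable (at x)" if "x \<in> {-1<..<1}" for x
    using Suc.prems that by auto
  have "vderiv (\<lambda>x. f x * g x) x = f x * vderiv g x + vderiv f x * g x" if "x \<in> {-1<..<1}" for x
    by (rule vderiv_eqI[OF has_vector_derivative_mult[OF has_vector_derivative_vderiv[OF fg(1)[OF that]]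
          has_vector_derivative_vderiv[OF fg(2)[OF that]]]])
  moreover have 1: "wbounded m (a + c - 1) (b + d - 1) (\<lambda>x. f x * vderiv g x)"
    using Suc.IH[OF wbounded_le[OF Suc.prems(1)], of "c - 1" "d - 1" "vderiv g"] Suc.prems
    by (simp add: add_diff_eq)
  have 2: "wbounded m (a + c - 1) (b + d - 1) (\<lambda>x. vderiv f x * g x)"
    using Suc.IH[OF _ wbounded_le[OF Suc.prems(2)], of "a - 1" "b - 1" "vderiv f"] Suc.prems
    by (simp add: diff_add_eq)
  ultimately have "wbounded m (a + c - 1) (b + d - 1) (vderiv (\<lambda>x. f x * g x))"
    using wbounded_cong[OF wbounded_add[OF 1 2]] by blast
  moreover have "(\<lambda>x. f x * g x) differentiable (at x)" if "x \<in> {-1<..<1}" for x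
    using fg[OF that] by (rule differentiable_mult)
  ultimately show ?case using Suc.prems wbound_mult by simp
qed

lemma wbounded_const: "wbounded m 0 0 (\<lambda>x. c)"
  by (cases m) (simp_all add: wbound_const vderiv_def[abs_def])

lemma wbounded_cmult: "wbounded m a b f \<Longrightarrow> wbounded m a b (\<lambda>x. c * f x)"
  using wbounded_mult[OF wbounded_const, of m a b f c] by simp

text \<open>Differentiating a weight lowers one exponent in each of two terms; monotonicity of the
  classes lowers the other exponent as well.\<close>

lemma wbounded_cweight: "wbounded m a b (cweight a b)"
proof (induction m arbitrary: a b)
  case (Suc m)
  have "vderiv (cweight a b) x = of_real b * cweight a (b - 1) x + (- of_real a) * cweight (a - 1) b x"
    if "x \<in> {-1<..<1}" for x
    using vderiv_eqI[OF has_vector_derivative_cweight[OF that]] by simp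
  moreover have 1: "wbounded m (a - 1) (b - 1) (\<lambda>x. of_real b * cweight a (b - 1) x)"
    by (rule wbounded_cmult, rule wbounded_mono[OF Suc.IH]) auto
  have 2: "wbounded m (a - 1) (b - 1) (\<lambda>x. (- of_real a) * cweight (a - 1) b x)"
    by (rule wbounded_cmult, rule wbounded_mono[OF Suc.IH]) auto
  ultimately have "wbounded m (a - 1) (b - 1) (vderiv (cweight a b))"
    using wbounded_cong[OF wbounded_add[OF 1 2]] by blast
  moreover have "cweight a b differentiable (at x)" if "x \<in> {-1<..<1}" for x
    by (rule differentiableI_vector[OF has_vector_derivative_cweight[OF that]])
  ultimately show ?case by (simp add: wbound_cweight)
qed (simp add: wbound_cweight)

lemma vderiv_cnj:
  assumes "h differentiable (at x)"
  shows "((\<lambda>z. cnj (h z)) has_vector_derivative cnj (vderiv h x)) (at x)"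
  using has_vector_derivative_cnj has_vector_derivative_vderiv[OF assms] by blast

lemma wbound_cnj: "wbound a b h \<Longrightarrow> wbound a b (\<lambda>x. cnj (h x))"
  by (erule wbound_le) simp

lemma wbounded_cnj: "wbounded m a b h \<Longrightarrow> wbounded m a b (\<lambda>x. cnj (h x))"
proof (induction m arbitrary: a b h)
  case 0
  then show ?case using wbound_cnj by simp
next
  case (Suc m)
  have h: "h differentiable (at x)" if "x \<in> {-1<..<1}" for x
    using Suc.prems that by simp
  have "wbounded m (a - 1) (b - 1) (\<lambda>x. cnj (vderiv h x))"
    using Suc.IH[of "a - 1" "b - 1" "vderiv h"] Suc.prems by simp
  then have "wbounded m (a - 1) (b - 1) (vderiv (\<lambda>x. cnj (h x)))"
    by (rule wbounded_cong) (rule vderiv_eqI[OF vderiv_cnj[OF h]])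
  moreover have "\<forall>x\<in>{-1<..<1}. (\<lambda>x. cnj (h x)) differentiable (at x)"
    using differentiableI_vector[OF vderiv_cnj[OF h]] by blast
  moreover have "wbound a b (\<lambda>x. cnj (h x))" using Suc.prems wbound_cnj by simp
  ultimately show ?case unfolding wbounded.simps by blast
qed

lemma wbounded_nderiv:
  "wbounded (m + j) a b h \<Longrightarrow> wbounded m (a - real j) (b - real j) (nderiv j h)"
proof (induction j arbitrary: a b h)
  case (Suc j)
  then have "wbounded (m + j) (a - 1) (b - 1) (vderiv h)" by simp
  from Suc.IH[OF this] have "wbounded m (a - 1 - real j) (b - 1 - real j) (nderiv (Suc j) h)"
    by (simp only: nderiv_Suc_right)
  moreover have "a - 1 - real j = a - real (Suc j)" "b - 1 - real j = b - real (Suc j)" by simp_all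
  ultimately show ?case by (simp only:)
qed simp

lemma wbounded_imp_differentiable:
  "wbounded m a b h \<Longrightarrow> j < m \<Longrightarrow> x \<in> {-1<..<1} \<Longrightarrow> nderiv j h differentiable (at x)"
  using wbounded_nderiv[OF wbounded_le[of m a b h "Suc 0 + j"]] by simp

lemma norm_diff_le_of_deriv_bound:
  fixes f :: "real \<Rightarrow> complex"
  assumes "u \<le> v" and uv: "{u..v} \<subseteq> {-1<..<1}"
    and f: "\<And>x. x \<in> {-1<..<1} \<Longrightarrow> f differentiable (at x)"
    and \<phi>: "\<And>x. x \<in> {-1<..<1} \<Longrightarrow> (\<phi> has_real_derivative \<phi>' x) (at x)"
    and le: "\<And>x. x \<in> {u..v} \<Longrightarrow> norm (vderiv f x) \<le> \<phi>' x"
  shows "norm (f v - f u) \<le> \<phi> v - \<phi> u"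
proof (cases "u = v")
  case False
  show ?thesis
  proof (rule differentiable_bound_general)
    show "u < v" using False assms(1) by simp
    show "continuous_on {u..v} f"
      using f uv by (intro continuous_at_imp_continuous_on ballI differentiable_imp_continuous_within) blast
    show "continuous_on {u..v} \<phi>"
      using \<phi> uv by (intro continuous_at_imp_continuous_on ballI DERIV_isCont) blast
    show "(f has_vector_derivative vderiv f x) (at x)" if "u < x" "x < v" for x
    proof -
      have "x \<in> {-1<..<1}" using uv that by (meson atLeastAtMost_iff less_imp_le subsetD)
      then show ?thesis by (intro has_vector_derivative_vderiv f)
    qed
    show "(\<phi> has_vector_derivative \<phi>' x) (at x)" if "u < x" "x < v" for x
    proof -
      have "x \<in> {-1<..<1}" using uv that by (meson atLeastAtMost_iff less_imp_le subsetD)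
      then show ?thesis using \<phi> by (simp add: has_real_derivative_iff_has_vector_derivative)
    qed
    show "norm (vderiv f x) \<le> \<phi>' x" if "u < x" "x < v" for x using le that by simp
  qed
qed simp

lemma jacobi_weight_bounded_on_Icc:
  assumes "-1 < c" "d < 1"
  obtains M where "M \<ge> 0" "\<And>x. x \<in> {c..d} \<Longrightarrow> jacobi_weight a b x \<le> M"
proof -
  have "{c..d} \<subseteq> {-1<..<1}" using assms by auto
  then have "continuous_on {c..d} (jacobi_weight a b)"
    using has_real_derivative_jacobi_weight
    by (intro continuous_at_imp_continuous_on ballI DERIV_isCont) blast
  then have "bounded (jacobi_weight a b ` {c..d})"
    by (intro compact_imp_bounded compact_continuous_image) auto
  then obtain M where "\<And>x. x \<in> {c..d} \<Longrightarrow> norm (jacobi_weight a b x) \<le> M" unfolding bounded_iff by blast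
  then show thesis by (intro that[of "max M 0"]) (auto simp: le_max_iff_disj)
qed

text \<open>Weights are bounded on compact subintervals, so the bound on the derivative makes
  \<open>h\<close> locally Lipschitz.\<close>

lemma AC_loc_wbounded:
  assumes "wbounded (Suc 0) a b h"
  shows "AC_loc h"
  unfolding AC_loc_def
proof (intro allI impI)
  fix c d :: real assume cd: "-1 < c" "c < d" "d < 1"
  have diff: "h differentiable (at x)" if "x \<in> {-1<..<1}" for x using assms that by simp
  obtain K where K: "K \<ge> 0" "\<And>x. x \<in> {-1<..<1} \<Longrightarrow> norm (vderiv h x) \<le> K * jacobi_weight (a - 1) (b - 1) x"
    using assms wboundE[of "a - 1" "b - 1" "vderiv h"] by auto
  obtain M where M: "M \<ge> 0" "\<And>x. x \<in> {c..d} \<Longrightarrow> jacobi_weight (a - 1) (b - 1) x \<le> M"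
    using jacobi_weight_bounded_on_Icc[OF cd(1,3)] by blast
  have *: "norm (h v - h u) \<le> K * M * (v - u)" if "u \<le> v" "u \<in> {c..d}" "v \<in> {c..d}" for u v
  proof -
    have "norm (h v - h u) \<le> K * M * v - K * M * u"
    proof (rule norm_diff_le_of_deriv_bound[where \<phi> = "\<lambda>x. K * M * x"])
      show "u \<le> v" "{u..v} \<subseteq> {-1<..<1}" using that cd by auto
      show "((\<lambda>x. K * M * x) has_real_derivative K * M) (at x)" for x
        by (auto intro!: derivative_eq_intros)
      fix x assume x: "x \<in> {u..v}"
      have "K * jacobi_weight (a - 1) (b - 1) x \<le> K * M" using M(2)[of x] x that K(1) by (intro mult_left_mono) auto
      moreover have "x \<in> {-1<..<1}" using x that cd by auto
      ultimately show "norm (vderiv h x) \<le> K * M" using K(2)[of x] by linarith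
    qed (rule diff)
    then show ?thesis by (simp add: right_diff_distrib)
  qed
  show "abs_continuous_on {c..d} h"
  proof (rule abs_continuous_on_dominated[OF abs_continuous_on_of_real abs_continuous_on_of_real, where M = "K * M" and L = 0])
    fix x y assume xy: "x \<in> {c..d}" "y \<in> {c..d}"
    have "norm (complex_of_real x - of_real y) = \<bar>x - y\<bar>" by (metis norm_of_real of_real_diff)
    then show "norm (h x - h y) \<le> K * M * norm (complex_of_real x - of_real y) + 0 * norm (complex_of_real x - of_real y)"
      using *[of x y] *[of y x] xy by (cases "x \<le> y") (auto simp: norm_minus_commute)
  qed (use K M in auto)
qed

text \<open>The regularity required in \<open>D_max\<close>, in recursive form so that inductions by
  the product rule apply. The derivative of order \<open>m\<close> is only locally absolutely
  continuous, so the next one may exist merely almost everywhere.\<close>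

primrec AC_diff :: "nat \<Rightarrow> (real \<Rightarrow> complex) \<Rightarrow> bool" where
  "AC_diff 0 h \<longleftrightarrow> AC_loc h"
| "AC_diff (Suc m) h \<longleftrightarrow> AC_loc h \<and> (\<forall>x\<in>{-1<..<1}. h differentiable (at x)) \<and> AC_diff m (vderiv h)"

lemma AC_diff_cong:
  assumes "AC_diff m h" "\<And>x. x \<in> {-1<..<1} \<Longrightarrow> k x = h x"
  shows "AC_diff m k"
  using assms
proof (induction m arbitrary: h k)
  case 0
  then show ?case using AC_loc_cong by auto
next
  case (Suc m)
  have "vderiv k x = vderiv h x" if "x \<in> {-1<..<1}" for x
    unfolding vderiv_def using vector_derivative_cong_open[OF open_greaterThanLessThan that] Suc.prems(2) by blast
  then have "AC_diff m (vderiv k)" using Suc.IH[of "vderiv h" "vderiv k"] Suc.prems by simp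
  moreover have "k differentiable (at x)" if "x \<in> {-1<..<1}" for x
    using differentiable_cong_open[OF open_greaterThanLessThan that, of h k] Suc.prems that by auto
  moreover have "AC_loc k" using AC_loc_cong[of h k] Suc.prems by simp
  ultimately show ?case by simp
qed

lemma AC_diff_Suc_imp: "AC_diff (Suc m) h \<Longrightarrow> AC_diff m h"
  by (induction m arbitrary: h) auto

lemma AC_diff_add: "AC_diff m f \<Longrightarrow> AC_diff m g \<Longrightarrow> AC_diff m (\<lambda>x. f x + g x)"
proof (induction m arbitrary: f g)
  case 0
  then show ?case by (simp add: AC_loc_add)
next
  case (Suc m)
  have fg: "f differentiable (at x)" "g differentiable (at x)" if "x \<in> {-1<..<1}" for x
    using Suc.prems that by auto
  have "vderiv (\<lambda>x. f x + g x) x = vderiv f x + vderiv g x" if "x \<in> {-1<..<1}" for x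
    by (rule vderiv_eqI[OF has_vector_derivative_add[OF has_vector_derivative_vderiv[OF fg(1)[OF that]]
          has_vector_derivative_vderiv[OF fg(2)[OF that]]]])
  moreover have "AC_diff m (\<lambda>x. vderiv f x + vderiv g x)" using Suc by simp
  ultimately have "AC_diff m (vderiv (\<lambda>x. f x + g x))" using AC_diff_cong by blast
  then show ?case using Suc.prems AC_loc_add by simp
qed

lemma AC_diff_mult: "AC_diff m f \<Longrightarrow> AC_diff m g \<Longrightarrow> AC_diff m (\<lambda>x. f x * g x)"
proof (induction m arbitrary: f g)
  case 0
  then show ?case by (simp add: AC_loc_mult)
next
  case (Suc m)
  have fg: "f differentiable (at x)" "g differentiable (at x)" if "x \<in> {-1<..<1}" for x
    using Suc.prems that by auto
  have "vderiv (\<lambda>x. f x * g x) x = f x * vderiv g x + vderiv f x * g x" if "x \<in> {-1<..<1}" for x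
    by (rule vderiv_eqI[OF has_vector_derivative_mult[OF has_vector_derivative_vderiv[OF fg(1)[OF that]]
          has_vector_derivative_vderiv[OF fg(2)[OF that]]]])
  moreover have "AC_diff m (\<lambda>x. f x * vderiv g x + vderiv f x * g x)"
    using Suc.prems by (intro AC_diff_add Suc.IH AC_diff_Suc_imp[OF Suc.prems(1)] AC_diff_Suc_imp[OF Suc.prems(2)]) simp_all
  ultimately have "AC_diff m (vderiv (\<lambda>x. f x * g x))" using AC_diff_cong by blast
  moreover have "(\<lambda>x. f x * g x) differentiable (at x)" if "x \<in> {-1<..<1}" for x
    using fg[OF that] by (rule differentiable_mult)
  ultimately show ?case using Suc.prems AC_loc_mult by simp
qed

lemma AC_diff_wbounded: "wbounded (Suc m) a b h \<Longrightarrow> AC_diff m h"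
proof (induction m arbitrary: a b h)
  case 0
  then show ?case using AC_loc_wbounded by simp
next
  case (Suc m)
  have "wbounded (Suc 0) a b h" using Suc.prems by (rule wbounded_le) simp
  then have "AC_loc h" by (rule AC_loc_wbounded)
  moreover have "AC_diff m (vderiv h)" using Suc.IH[of "a - 1" "b - 1" "vderiv h"] Suc.prems by simp
  ultimately show ?case using Suc.prems by simp
qed

lemma AC_diffI:
  assumes "\<And>j x. j < m \<Longrightarrow> x \<in> {-1<..<1} \<Longrightarrow> nderiv j h differentiable (at x)"
    and "\<And>j. j \<le> m \<Longrightarrow> AC_loc (nderiv j h)"
  shows "AC_diff m h"
  using assms
proof (induction m arbitrary: h)
  case 0
  then show ?case using 0(2)[of 0] by simp
next
  case (Suc m)
  have "AC_diff m (vderiv h)"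
  proof (rule Suc.IH)
    show "nderiv j (vderiv h) differentiable (at x)" if "j < m" "x \<in> {-1<..<1}" for j x
      using Suc.prems(1)[of "Suc j" x] that by (simp add: nderiv_Suc_right)
    show "AC_loc (nderiv j (vderiv h))" if "j \<le> m" for j
      using Suc.prems(2)[of "Suc j"] that by (simp add: nderiv_Suc_right)
  qed
  then show ?case using Suc.prems(1)[of 0] Suc.prems(2)[of 0] by simp
qed

subsection \<open>Regularity of solutions of the Jacobi equation\<close>

text \<open>On the open interval this is
  \<open>\<beta> - \<alpha> - (\<alpha> + \<beta> + 2) * x\<close>, the coefficient of the first
  derivative once the divergence form is expanded. Written through weights, it falls under the
  weight calculus.\<close>

definition jacobi_drift :: "real \<Rightarrow> real \<Rightarrow> real \<Rightarrow> complex" where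
  "jacobi_drift \<alpha> \<beta> x = of_real (\<beta> + 1) * cweight 1 0 x + (- of_real (\<alpha> + 1)) * cweight 0 1 x"

lemma wbounded_jacobi_drift: "wbounded m 0 0 (jacobi_drift \<alpha> \<beta>)"
proof -
  have 1: "wbounded m 0 0 (\<lambda>x. of_real (\<beta> + 1) * cweight 1 0 x)"
    by (rule wbounded_cmult, rule wbounded_mono[OF wbounded_cweight]) auto
  have 2: "wbounded m 0 0 (\<lambda>x. (- of_real (\<alpha> + 1)) * cweight 0 1 x)"
    by (rule wbounded_cmult, rule wbounded_mono[OF wbounded_cweight]) auto
  show ?thesis by (rule wbounded_cong[OF wbounded_add[OF 1 2]]) (simp add: jacobi_drift_def)
qed

lemma jacobi_expr_altdef:
  assumes x: "x \<in> {-1<..<1}"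
  shows "jacobi_expr \<alpha> \<beta> f x = - (1 / cweight \<alpha> \<beta> x) * vderiv (\<lambda>y. cweight (\<alpha> + 1) (\<beta> + 1) y * vderiv f y) x"
  by (simp add: jacobi_expr_def nderiv_Suc_0 jacobi_weight_def)

lemma jacobi_expr_eq:
  assumes x: "x \<in> {-1<..<1}" and f: "vderiv f differentiable (at x)"
  shows "jacobi_expr \<alpha> \<beta> f x = - (cweight 1 1 x * vderiv (vderiv f) x + jacobi_drift \<alpha> \<beta> x * vderiv f x)"
proof -
  have w0: "cweight \<alpha> \<beta> x \<noteq> 0" using jacobi_weight_pos[OF x, of \<alpha> \<beta>] by simp
  have m: "cweight a b x * cweight c d x = cweight (a + c) (b + d) x" for a b c d
    using jacobi_weight_mult[OF x, of a b c d] by (metis of_real_mult)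
  have "vderiv (\<lambda>y. cweight (\<alpha> + 1) (\<beta> + 1) y * vderiv f y) x =
     cweight (\<alpha> + 1) (\<beta> + 1) x * vderiv (vderiv f) x +
     (of_real (\<beta> + 1) * cweight (\<alpha> + 1) (\<beta> + 1 - 1) x - of_real (\<alpha> + 1) * cweight (\<alpha> + 1 - 1) (\<beta> + 1) x) * vderiv f x"
    by (rule vderiv_eqI[OF has_vector_derivative_mult[OF has_vector_derivative_cweight[OF x] has_vector_derivative_vderiv[OF f]]])
  also have "\<dots> = cweight \<alpha> \<beta> x * (cweight 1 1 x * vderiv (vderiv f) x + jacobi_drift \<alpha> \<beta> x * vderiv f x)"
    using m[of \<alpha> \<beta> 1 1] m[of \<alpha> \<beta> 1 0] m[of \<alpha> \<beta> 0 1]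
    by (simp add: jacobi_drift_def algebra_simps)
  finally show ?thesis using w0 by (simp add: jacobi_expr_altdef[OF x])
qed

text \<open>The second derivative costs two powers and its coefficient \<open>cweight 1 1\<close>
  returns one; the first-order term costs one power. The net loss is one.\<close>

lemma wbounded_jacobi_expr:
  assumes "wbounded (Suc (Suc m)) a b f"
  shows "wbounded m (a - 1) (b - 1) (jacobi_expr \<alpha> \<beta> f)"
proof -
  have 1: "wbounded m (a - 1) (b - 1) (\<lambda>x. cweight 1 1 x * vderiv (vderiv f) x)"
    using wbounded_mult[OF wbounded_cweight[of m 1 1], of "a - 2" "b - 2" "vderiv (vderiv f)"] assms
    by (simp add: diff_diff_eq)
  have "wbounded m (a - 1) (b - 1) (vderiv f)"
    using wbounded_le[of "Suc m" "a - 1" "b - 1" "vderiv f" m] assms by simp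
  from wbounded_mult[OF wbounded_jacobi_drift this]
  have 2: "wbounded m (a - 1) (b - 1) (\<lambda>x. jacobi_drift \<alpha> \<beta> x * vderiv f x)" by simp
  have "jacobi_expr \<alpha> \<beta> f x = (- 1) * (cweight 1 1 x * vderiv (vderiv f) x + jacobi_drift \<alpha> \<beta> x * vderiv f x)"
    if "x \<in> {-1<..<1}" for x
    using jacobi_expr_eq[OF that] assms that by simp
  then show ?thesis using wbounded_cong[OF wbounded_cmult[OF wbounded_add[OF 1 2]]] by blast
qed

lemma AC_diff_jacobi_expr:
  assumes "AC_diff (Suc (Suc m)) f"
  shows "AC_diff m (jacobi_expr \<alpha> \<beta> f)"
proof -
  have 1: "AC_diff m (\<lambda>x. cweight 1 1 x * vderiv (vderiv f) x)"
    using assms by (intro AC_diff_mult AC_diff_wbounded[OF wbounded_cweight]) simp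
  have "AC_diff m (vderiv f)" by (rule AC_diff_Suc_imp) (use assms in simp)
  then have 2: "AC_diff m (\<lambda>x. jacobi_drift \<alpha> \<beta> x * vderiv f x)"
    by (rule AC_diff_mult[OF AC_diff_wbounded[OF wbounded_jacobi_drift]])
  have 3: "AC_diff m (\<lambda>x. - 1)" by (rule AC_diff_wbounded[OF wbounded_const])
  have "jacobi_expr \<alpha> \<beta> f x = (- 1) * (cweight 1 1 x * vderiv (vderiv f) x + jacobi_drift \<alpha> \<beta> x * vderiv f x)"
    if "x \<in> {-1<..<1}" for x
    using jacobi_expr_eq[OF that] assms that by simp
  then show ?thesis using AC_diff_cong[OF AC_diff_mult[OF 3 AC_diff_add[OF 1 2]]] by blast
qed

section \<open>Weighted integration and the iteration step\<close>

text \<open>Integration from 0 outwards. On each half of the interval one of the two singular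
  factors is at most 1, so the product of the factors is dominated by their sum, and each one-sided
  power has an elementary antiderivative.\<close>

lemma wbound_antiderivative:
  assumes e: "e > 0" "e' > 0" and diff: "\<And>x. x \<in> {-1<..<1} \<Longrightarrow> h differentiable (at x)"
    and h': "wbound (- e - 1) (- e' - 1) (vderiv h)"
  shows "wbound (- e) (- e') h"
proof -
  obtain K where K: "K \<ge> 0" "\<And>x. x \<in> {-1<..<1} \<Longrightarrow> norm (vderiv h x) \<le> K * jacobi_weight (- e - 1) (- e' - 1) x"
    using wboundE[OF h'] by blast
  define c where "c = min e e'"
  have c: "c > 0" "c \<le> e" "c \<le> e'" using e by (auto simp: c_def)
  \<comment> \<open>An increasing majorant with value 0 at 0. Dividing by \<open>c\<close>, the
    smaller exponent, compensates for the factors \<open>e\<close> and \<open>e'\<close> that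
    differentiation brings down.\<close>
  define \<phi> where "\<phi> x = (K / c) * (jacobi_weight (- e) 0 x - jacobi_weight 0 (- e') x)" for x
  define \<phi>' where "\<phi>' x = (K / c) * (e * jacobi_weight (- e - 1) 0 x + e' * jacobi_weight 0 (- e' - 1) x)" for x
  have der: "(\<phi> has_real_derivative \<phi>' x) (at x)" if x: "x \<in> {-1<..<1}" for x
  proof -
    have "(\<phi> has_real_derivative (K / c) *
        ((0 * jacobi_weight (- e) (0 - 1) x - (- e) * jacobi_weight (- e - 1) 0 x)
        - (- e' * jacobi_weight 0 (- e' - 1) x - 0 * jacobi_weight (0 - 1) (- e') x))) (at x)"
      unfolding \<phi>_def by (intro DERIV_cmult DERIV_diff has_real_derivative_jacobi_weight x)
    then show ?thesis by (simp add: \<phi>'_def)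
  qed
  have le: "norm (vderiv h x) \<le> \<phi>' x" if x: "x \<in> {-1<..<1}" for x
  proof -
    let ?A = "jacobi_weight (- e - 1) 0 x" and ?B = "jacobi_weight 0 (- e' - 1) x"
    have "jacobi_weight (- e - 1) (- e' - 1) x \<le> ?A + ?B"
    proof (cases "x \<ge> 0")
      case True
      have "(1 + x) powr (- e' - 1) \<le> (1 + x) powr 0" using True e by (intro powr_mono) auto
      then have "jacobi_weight (- e - 1) (- e' - 1) x \<le> ?A"
        unfolding jacobi_weight_def using True by (intro mult_left_mono) auto
      then show ?thesis using jacobi_weight_nonneg[of 0 "- e' - 1" x] by linarith
    next
      case False
      have "(1 - x) powr (- e - 1) \<le> (1 - x) powr 0" using False e by (intro powr_mono) auto
      then have "jacobi_weight (- e - 1) (- e' - 1) x \<le> ?B"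
        unfolding jacobi_weight_def using False x by (intro mult_right_mono) auto
      then show ?thesis using jacobi_weight_nonneg[of "- e - 1" 0 x] by linarith
    qed
    then have "c * jacobi_weight (- e - 1) (- e' - 1) x \<le> c * ?A + c * ?B"
      using c by (simp flip: distrib_left)
    also have "\<dots> \<le> e * ?A + e' * ?B" using c by (intro add_mono mult_right_mono) auto
    finally have "(K / c) * (c * jacobi_weight (- e - 1) (- e' - 1) x) \<le> \<phi>' x"
      unfolding \<phi>'_def using K(1) c by (intro mult_left_mono) auto
    then show ?thesis using K(2)[OF x] c by simp
  qed
  have \<phi>0: "\<phi> 0 = 0" by (simp add: \<phi>_def jacobi_weight_def)
  \<comment> \<open>The bound is written as the norm of a complex function, so that the closure
    rules for \<open>wbound\<close> apply to it.\<close>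
  have bd: "norm (h x) \<le> norm (complex_of_real (norm (h 0)) +
      of_real (K / c) * (cweight (- e) 0 x + cweight 0 (- e') x))" if x: "x \<in> {-1<..<1}" for x
  proof -
    let ?R = "norm (h 0) + (K / c) * (jacobi_weight (- e) 0 x + jacobi_weight 0 (- e') x)"
    have "norm (h x - h 0) \<le> \<bar>\<phi> x\<bar>"
    proof (cases "x \<ge> 0")
      case True
      have "norm (h x - h 0) \<le> \<phi> x - \<phi> 0"
        by (rule norm_diff_le_of_deriv_bound[OF True _ diff der le]) (use x True in auto)
      then show ?thesis using \<phi>0 by simp
    next
      case False
      then have "x \<le> 0" by simp
      then have "norm (h 0 - h x) \<le> \<phi> 0 - \<phi> x"
        by (rule norm_diff_le_of_deriv_bound[OF _ _ diff der le]) (use x False in auto)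
      then show ?thesis using \<phi>0 by (simp add: norm_minus_commute)
    qed
    also have "\<bar>\<phi> x\<bar> \<le> (K / c) * (jacobi_weight (- e) 0 x + jacobi_weight 0 (- e') x)"
      unfolding \<phi>_def abs_mult using K(1) c
      by (intro mult_mono) (auto simp: abs_le_iff intro: add_increasing add_increasing2)
    finally have "norm (h x) \<le> ?R" using norm_triangle_sub[of "h x" "h 0"] by linarith
    also have "?R = norm (complex_of_real ?R)"
      using K(1) c unfolding norm_of_real by (intro abs_of_nonneg[symmetric]) auto
    finally show ?thesis by simp
  qed
  have 1: "wbound (- e) (- e') (\<lambda>x. complex_of_real (norm (h 0)))"
    by (rule wbound_mono[OF wbound_const]) (use e in auto)
  have "wbound 0 0 (\<lambda>x. complex_of_real (K / c))" by (rule wbound_const)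
  moreover have "wbound (- e) (- e') (\<lambda>x. cweight (- e) 0 x + cweight 0 (- e') x)"
    by (intro wbound_add wbound_mono[OF wbound_cweight]) (use e in auto)
  ultimately have "wbound (0 + - e) (0 + - e') (\<lambda>x. of_real (K / c) * (cweight (- e) 0 x + cweight 0 (- e') x))"
    by (rule wbound_mult)
  then have "wbound (- e) (- e') (\<lambda>x. of_real (norm (h 0)) + of_real (K / c) * (cweight (- e) 0 x + cweight 0 (- e') x))"
    using wbound_add[OF 1] by simp
  then show ?thesis using wbound_le bd by blast
qed

text \<open>The loss of \<open>1/2\<close> in the exponents (any number in \<open>(0, 1)\<close> would do) avoids the logarithms
  that occur for \<open>\<alpha> = 0\<close> or \<open>\<beta> = 0\<close>.\<close>

lemma wbound_of_flux:
  assumes ab: "\<alpha> > - 1 / 2" "\<beta> > - 1 / 2"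
    and diff: "\<And>x. x \<in> {-1<..<1} \<Longrightarrow> v differentiable (at x)"
    and F: "wbound (- 1 / 2) (- 1 / 2) (\<lambda>y. cweight (\<alpha> + 1) (\<beta> + 1) y * vderiv v y)"
  shows "wbound (- (\<alpha> + 1 / 2) - 1) (- (\<beta> + 1 / 2) - 1) (vderiv v)"
    and "wbound (- (\<alpha> + 1 / 2)) (- (\<beta> + 1 / 2)) v"
proof -
  have "wbound (- \<alpha> - 1 + - 1 / 2) (- \<beta> - 1 + - 1 / 2)
      (\<lambda>x. cweight (- \<alpha> - 1) (- \<beta> - 1) x * (cweight (\<alpha> + 1) (\<beta> + 1) x * vderiv v x))"
    by (rule wbound_mult[OF wbound_cweight F])
  then have "wbound (- \<alpha> - 1 + - 1 / 2) (- \<beta> - 1 + - 1 / 2) (vderiv v)"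
  proof (rule wbound_cong)
    fix x :: real assume x: "x \<in> {-1<..<1}"
    have "cweight (- \<alpha> - 1) (- \<beta> - 1) x * cweight (\<alpha> + 1) (\<beta> + 1) x = 1"
      using jacobi_weight_mult[OF x, of "- \<alpha> - 1" "- \<beta> - 1" "\<alpha> + 1" "\<beta> + 1"] jacobi_weight_0[OF x]
      by (simp flip: of_real_mult)
    then show "vderiv v x = cweight (- \<alpha> - 1) (- \<beta> - 1) x * (cweight (\<alpha> + 1) (\<beta> + 1) x * vderiv v x)"
      by (simp flip: mult.assoc)
  qed
  moreover have "- \<alpha> - 1 + - 1 / 2 = - (\<alpha> + 1 / 2) - 1" "- \<beta> - 1 + - 1 / 2 = - (\<beta> + 1 / 2) - 1" by simp_all
  ultimately show *: "wbound (- (\<alpha> + 1 / 2) - 1) (- (\<beta> + 1 / 2) - 1) (vderiv v)" by (simp only:)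
  show "wbound (- (\<alpha> + 1 / 2)) (- (\<beta> + 1 / 2)) v"
    by (rule wbound_antiderivative[OF _ _ diff *]) (use ab in auto)
qed

text \<open>A rearrangement of the definition of \<open>jacobi_expr\<close>, which contains this
  very derivative. It is therefore valid at every point, including those where the flux is not
  differentiable and both sides contain the same unspecified value.\<close>

lemma vderiv_flux:
  assumes x: "x \<in> {-1<..<1}"
  shows "vderiv (\<lambda>y. cweight (\<alpha> + 1) (\<beta> + 1) y * vderiv f y) x = - (cweight \<alpha> \<beta> x * jacobi_expr \<alpha> \<beta> f x)"
  using jacobi_weight_pos[OF x, of \<alpha> \<beta>] by (simp add: jacobi_expr_altdef[OF x])

text \<open>Two integrations recover for \<open>v\<close> the exponents assumed for
  \<open>jacobi_expr \<alpha> \<beta> v\<close>, so the step can be repeated without further loss.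
  The equation solved for the second derivative then supplies two more orders of
  differentiability.\<close>

lemma wbounded_of_jacobi_expr:
  assumes ab: "\<alpha> > - 1 / 2" "\<beta> > - 1 / 2"
    and diff: "\<And>x. x \<in> {-1<..<1} \<Longrightarrow> v differentiable (at x)" "\<And>x. x \<in> {-1<..<1} \<Longrightarrow> vderiv v differentiable (at x)"
    and u: "wbounded m (- (\<alpha> + 1 / 2)) (- (\<beta> + 1 / 2)) (jacobi_expr \<alpha> \<beta> v)"
  shows "wbounded (Suc (Suc m)) (- (\<alpha> + 1 / 2)) (- (\<beta> + 1 / 2)) v"
proof -
  define ga gb where "ga = \<alpha> + 1 / 2" and "gb = \<beta> + 1 / 2"
  let ?F = "\<lambda>y. cweight (\<alpha> + 1) (\<beta> + 1) y * vderiv v y"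
  have Fdiff: "?F differentiable (at x)" if "x \<in> {-1<..<1}" for x
    using that diff(2) differentiableI_vector[OF has_vector_derivative_cweight[OF that]] by (intro differentiable_mult)
  have "wbound (\<alpha> + - (\<alpha> + 1 / 2)) (\<beta> + - (\<beta> + 1 / 2)) (\<lambda>x. cweight \<alpha> \<beta> x * jacobi_expr \<alpha> \<beta> v x)"
    by (rule wbound_mult[OF wbound_cweight wbounded_imp_wbound[OF u]])
  then have "wbound (\<alpha> + - (\<alpha> + 1 / 2)) (\<beta> + - (\<beta> + 1 / 2)) (vderiv ?F)"
    by (rule wbound_le) (simp add: vderiv_flux)
  \<comment> \<open>The exponent -1/2 just obtained is weakened to -3/2, so that integration ends at
    -1/2, a negative exponent within reach of \<open>wbound_antiderivative\<close>.\<close>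
  then have "wbound (- (1 / 2) - 1) (- (1 / 2) - 1) (vderiv ?F)" by (rule wbound_mono) auto
  then have "wbound (- (1 / 2)) (- (1 / 2)) ?F"
    by (intro wbound_antiderivative Fdiff) auto
  then have F: "wbound (- 1 / 2) (- 1 / 2) ?F" by simp
  note v1 = wbound_of_flux(1)[OF ab diff(1) F, folded ga_def gb_def]
  note v0 = wbound_of_flux(2)[OF ab diff(1) F, folded ga_def gb_def]
  \<comment> \<open>The equation is solved for the second derivative; division by
    \<open>cweight 1 1\<close> costs one power.\<close>
  have v2: "wbounded k (- ga - 1 - 1) (- gb - 1 - 1) (vderiv (vderiv v))"
    if "wbounded k (- ga - 1) (- gb - 1) (vderiv v)" "k \<le> m" for k
  proof -
    have u': "wbounded k (- ga - 1) (- gb - 1) (jacobi_expr \<alpha> \<beta> v)"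
      by (rule wbounded_mono[OF wbounded_le[OF u that(2)]]) (auto simp: ga_def gb_def)
    have d: "wbounded k (- ga - 1) (- gb - 1) (\<lambda>x. jacobi_drift \<alpha> \<beta> x * vderiv v x)"
      using wbounded_mult[OF wbounded_jacobi_drift that(1)] by simp
    have "wbounded k (- 1 + (- ga - 1)) (- 1 + (- gb - 1))
        (\<lambda>x. cweight (- 1) (- 1) x * ((- 1) * (jacobi_expr \<alpha> \<beta> v x + jacobi_drift \<alpha> \<beta> x * vderiv v x)))"
      by (rule wbounded_mult[OF wbounded_cweight wbounded_cmult[OF wbounded_add[OF u' d]]])
    then have "wbounded k (- 1 + (- ga - 1)) (- 1 + (- gb - 1)) (vderiv (vderiv v))"
    proof (rule wbounded_cong)
      fix x :: real assume x: "x \<in> {-1<..<1}"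
      have "cweight (- 1) (- 1) x * cweight 1 1 x = 1"
        using jacobi_weight_mult[OF x, of "- 1" "- 1" 1 1] jacobi_weight_0[OF x]
        by (simp flip: of_real_mult)
      then show "vderiv (vderiv v) x = cweight (- 1) (- 1) x * ((- 1) * (jacobi_expr \<alpha> \<beta> v x + jacobi_drift \<alpha> \<beta> x * vderiv v x))"
        using jacobi_expr_eq[OF x diff(2)[OF x], of \<alpha> \<beta>] by (simp flip: mult.assoc)
    qed
    moreover have "- 1 + (- ga - 1) = - ga - 1 - 1" "- 1 + (- gb - 1) = - gb - 1 - 1" by simp_all
    ultimately show ?thesis by (simp only:)
  qed
  \<comment> \<open>Bootstrap: by \<open>v2\<close>, control of \<open>k\<close> derivatives of
    \<open>vderiv v\<close> gives control of \<open>k\<close> derivatives of its derivative, hence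
    of \<open>k + 1\<close> derivatives of \<open>vderiv v\<close>.\<close>
  have "wbounded (Suc k) (- ga - 1) (- gb - 1) (vderiv v)" if "k \<le> m" for k
    using that
  proof (induction k)
    case 0
    then show ?case using v1 v2[of 0] diff(2) by simp
  next
    case (Suc k)
    then have "wbounded (Suc k) (- ga - 1 - 1) (- gb - 1 - 1) (vderiv (vderiv v))" using v2[of "Suc k"] by simp
    then show ?case using v1 diff(2) by simp
  qed
  then have "wbounded (Suc m) (- ga - 1) (- gb - 1) (vderiv v)" by blast
  then have "wbounded (Suc (Suc m)) (- ga) (- gb) v" using v0 diff(1) by simp
  then show ?thesis by (simp add: ga_def gb_def)
qed

section \<open>Starting the iteration from square integrability\<close>

text \<open>The inequality \<open>norm q <= (norm q)^2 + 1\<close> takes the place of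
  Cauchy-Schwarz. The weight is integrable because nonnegative exponents make it bounded on an
  interval of finite length.\<close>

lemma integrable_weight_mult_L2:
  assumes ab: "\<alpha> \<ge> 0" "\<beta> \<ge> 0" and q: "q \<in> L2_jacobi \<alpha> \<beta>"
  shows "(\<lambda>x. cweight \<alpha> \<beta> x * q x) absolutely_integrable_on {-1<..<1}"
proof -
  let ?I = "{-1<..<1::real}" and ?w = "jacobi_weight \<alpha> \<beta>"
  have lm: "?I \<in> lmeasurable" by simp
  interpret finite_measure "lebesgue_on ?I" by (rule finite_measure_lebesgue_on[OF lm])
  have qm: "q \<in> borel_measurable (lebesgue_on ?I)" and q2: "integrable (lebesgue_on ?I) (\<lambda>x. (norm (q x))\<^sup>2 * ?w x)"
    using q by (auto simp: L2_jacobi_def)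
  have "continuous_on ?I ?w"
    using has_real_derivative_jacobi_weight by (intro continuous_at_imp_continuous_on ballI DERIV_isCont) blast
  then have wm: "?w \<in> borel_measurable (lebesgue_on ?I)"
    by (rule continuous_imp_measurable_on_sets_lebesgue) simp
  have wi: "integrable (lebesgue_on ?I) ?w"
    by (rule integrable_const_bound[where B = "2 powr \<alpha> * 2 powr \<beta>", OF _ wm])
       (use ab jacobi_weight_le[of _ \<alpha> \<beta>] in \<open>auto intro!: AE_I2 simp: abs_of_nonneg\<close>)
  have "integrable (lebesgue_on ?I) (\<lambda>x. cweight \<alpha> \<beta> x * q x)"
  proof (rule Bochner_Integration.integrable_bound[OF Bochner_Integration.integrable_add[OF q2 wi]])
    show "(\<lambda>x. cweight \<alpha> \<beta> x * q x) \<in> borel_measurable (lebesgue_on ?I)"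
      using wm qm by measurable
    show "AE x in lebesgue_on ?I. norm (cweight \<alpha> \<beta> x * q x) \<le> norm ((norm (q x))\<^sup>2 * ?w x + ?w x)"
    proof (rule AE_I2)
      fix x
      have "2 * norm (q x) \<le> (norm (q x))\<^sup>2 + 1"
        using zero_le_power2[of "norm (q x) - 1"] by (simp add: power2_diff)
      then have "norm (q x) \<le> (norm (q x))\<^sup>2 + 1" using norm_ge_zero[of "q x"] by linarith
      then have "norm (q x) * ?w x \<le> ((norm (q x))\<^sup>2 + 1) * ?w x" by (intro mult_right_mono) auto
      then show "norm (cweight \<alpha> \<beta> x * q x) \<le> norm ((norm (q x))\<^sup>2 * ?w x + ?w x)"
        by (simp add: norm_mult abs_of_nonneg algebra_simps)
    qed
  qed
  then show ?thesis
    unfolding set_integrable_def by (subst (asm) integrable_restrict_space) (auto simp: scaleR_conv_of_real)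
qed

text \<open>Every increment of \<open>F\<close> is an integral of \<open>G\<close> and thus bounded
  by the norm of \<open>G\<close> in L1 over the whole interval, uniformly up to the ends.\<close>

lemma AC_loc_bounded_of_integrable_deriv:
  assumes F: "AC_loc F" and G: "G absolutely_integrable_on {-1<..<1}"
    and FG: "\<And>x. x \<in> {-1<..<1} \<Longrightarrow> vderiv F x = G x"
  shows "wbound 0 0 F"
proof -
  let ?I = "{-1<..<1::real}"
  let ?B = "integral ?I (\<lambda>x. norm (G x))"
  have *: "norm (F d - F c) \<le> ?B" if cd: "-1 < c" "c \<le> d" "d < 1" for c d
  proof -
    \<comment> \<open>Almost everywhere differentiability is known on open intervals; the enlarged
      interval contains the ends \<open>c\<close> and \<open>d\<close> in its interior.\<close>
    define c' where "c' = (c - 1) / 2"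
    define d' where "d' = (d + 1) / 2"
    have c'd': "-1 < c'" "c' < c" "d < d'" "d' < 1" using cd by (auto simp: c'_def d'_def)
    define N where "N = {x \<in> {c'<..<d'}. \<not> F differentiable (at x)}"
    have sub: "{c..d} \<subseteq> ?I" using cd by auto
    have N: "negligible N" unfolding N_def
      by (rule abs_continuous_on_imp_ae_differentiable) (use F c'd' cd in \<open>simp add: AC_loc_def\<close>)
    have "abs_continuous_on {c'..d'} F" using F c'd' cd by (simp add: AC_loc_def)
    then have "abs_continuous_on {c..d} F"
      unfolding abs_continuous_on_def using c'd' by (meson atLeastatMost_subset_iff less_imp_le order_trans)
    then have "(vderiv F has_integral F d - F c) {c..d}"
    proof (rule abs_continuous_on_has_integral[OF cd(2) _ N])
      show "(F has_vector_derivative vderiv F x) (at x)" if "x \<in> {c..d} - N" for x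
        using that c'd' by (intro has_vector_derivative_vderiv) (auto simp: N_def)
    qed
    then have "(G has_integral F d - F c) {c..d}"
      by (rule has_integral_eq[rotated]) (use FG sub in auto)
    then have eq: "F d - F c = integral {c..d} G" by (simp add: integral_unique)
    have Gs: "G absolutely_integrable_on {c..d}"
      by (rule set_integrable_subset[OF G _ sub]) simp
    have "norm (F d - F c) \<le> integral {c..d} (\<lambda>x. norm (G x))"
      unfolding eq using Gs by (intro integral_norm_bound_integral) (auto simp: absolutely_integrable_on_def)
    also have "\<dots> \<le> ?B"
      using Gs G by (intro integral_subset_le[OF sub]) (auto simp: absolutely_integrable_on_def)
    finally show ?thesis .
  qed
  have "norm (F x) \<le> (norm (F 0) + ?B) * jacobi_weight 0 0 x" if x: "x \<in> ?I" for x
  proof -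
    have "norm (F x - F 0) \<le> ?B"
      using *[of 0 x] *[of x 0] x by (cases "x \<ge> 0") (auto simp: norm_minus_commute)
    then have "norm (F x) \<le> norm (F 0) + ?B" using norm_triangle_sub[of "F x" "F 0"] by linarith
    then show ?thesis using x by simp
  qed
  then show ?thesis unfolding wbound_def by blast
qed

lemma wbounded_of_jacobi_expr_L2:
  assumes ab: "\<alpha> \<ge> 0" "\<beta> \<ge> 0" and v: "AC_diff (Suc 0) v" and q: "jacobi_expr \<alpha> \<beta> v \<in> L2_jacobi \<alpha> \<beta>"
  shows "wbounded (Suc 0) (- (\<alpha> + 1 / 2)) (- (\<beta> + 1 / 2)) v"
proof -
  let ?F = "\<lambda>y. cweight (\<alpha> + 1) (\<beta> + 1) y * vderiv v y"
  have diff: "v differentiable (at x)" if "x \<in> {-1<..<1}" for x using v that by simp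
  have "AC_loc ?F"
    using v by (intro AC_loc_mult AC_loc_wbounded[OF wbounded_cweight]) simp
  moreover have "(\<lambda>x. - (cweight \<alpha> \<beta> x * jacobi_expr \<alpha> \<beta> v x)) absolutely_integrable_on {-1<..<1}"
    using integrable_weight_mult_L2[OF ab q] by (simp add: set_integrable_def)
  ultimately have "wbound 0 0 ?F"
    by (rule AC_loc_bounded_of_integrable_deriv) (rule vderiv_flux)
  \<comment> \<open>The bounded flux is weakened to the exponent -1/2, so that the start has the
    same exponents as the iteration.\<close>
  then have F: "wbound (- 1 / 2) (- 1 / 2) ?F" by (rule wbound_mono) auto
  have ab': "\<alpha> > - 1 / 2" "\<beta> > - 1 / 2" using ab by auto
  show ?thesis using wbound_of_flux[OF ab' diff F] diff by simp
qed

lemma jacobi_expr_pow_Suc: "jacobi_expr_pow (Suc n) \<alpha> \<beta> f = jacobi_expr_pow n \<alpha> \<beta> (jacobi_expr \<alpha> \<beta> f)"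
  by (simp add: jacobi_expr_pow_def funpow_swap1)

text \<open>\<open>n\<close> counts the inner applications of \<open>jacobi_expr\<close>. The
  outermost one is the base case and yields one derivative; each inner one adds two at unchanged
  exponents, up to order \<open>2 * Suc n - 1\<close>.\<close>

lemma wbounded_of_jacobi_expr_pow_L2:
  assumes ab: "\<alpha> \<ge> 0" "\<beta> \<ge> 0"
  shows "AC_diff (2 * n + 1) g \<Longrightarrow> jacobi_expr_pow (Suc n) \<alpha> \<beta> g \<in> L2_jacobi \<alpha> \<beta> \<Longrightarrow>
    wbounded (2 * n + 1) (- (\<alpha> + 1 / 2)) (- (\<beta> + 1 / 2)) g"
proof (induction n arbitrary: g)
  case 0
  then show ?case using wbounded_of_jacobi_expr_L2[OF ab, of g] by (simp add: jacobi_expr_pow_def)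
next
  case (Suc n)
  have g: "AC_diff (Suc (Suc (2 * n + 1))) g" using Suc.prems(1) by simp
  have "wbounded (2 * n + 1) (- (\<alpha> + 1 / 2)) (- (\<beta> + 1 / 2)) (jacobi_expr \<alpha> \<beta> g)"
    using Suc.IH[OF AC_diff_jacobi_expr[OF g]] Suc.prems(2) by (simp only: jacobi_expr_pow_Suc)
  moreover have "g differentiable (at x)" "vderiv g differentiable (at x)" if "x \<in> {-1<..<1}" for x
    using g that by simp_all
  ultimately have "wbounded (Suc (Suc (2 * n + 1))) (- (\<alpha> + 1 / 2)) (- (\<beta> + 1 / 2)) g"
    using ab by (intro wbounded_of_jacobi_expr) auto
  then show ?case by simp
qed

lemma D_max_imp_wbounded:
  assumes ab: "\<alpha> \<ge> 0" "\<beta> \<ge> 0" and n: "n \<ge> 1" and g: "g \<in> D_max n \<alpha> \<beta>"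
  shows "wbounded (2 * n - 1) (- (\<alpha> + 1 / 2)) (- (\<beta> + 1 / 2)) g"
proof -
  obtain m where m: "n = Suc m" using n by (cases n) auto
  have "AC_diff (2 * m + 1) g"
    using g unfolding D_max_def times_differentiable_def m by (intro AC_diffI) auto
  then show ?thesis
    using wbounded_of_jacobi_expr_pow_L2[OF ab, of m g] g m by (simp add: D_max_def)
qed

subsection \<open>The functions of the statement and the boundary form\<close>

text \<open>All derivatives are continuous on the compact interval and hence bounded, and negative
  exponents only weaken such a bound.\<close>

lemma wbounded_of_smooth:
  assumes d: "\<And>k x. x \<in> {-1..1} \<Longrightarrow> (d k has_vector_derivative d (Suc k) x) (at x within {-1..1})"
  shows "wbounded m 0 0 (d k)"
proof (induction m arbitrary: k)
  have b: "wbound 0 0 (d k)" for k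
  proof -
    have "continuous_on {-1..1} (d k)"
      using d has_vector_derivative_continuous unfolding continuous_on_eq_continuous_within by blast
    then have "bounded (d k ` {-1..1})"
      by (intro compact_imp_bounded compact_continuous_image) auto
    then obtain M where "\<And>x. x \<in> {-1..1} \<Longrightarrow> norm (d k x) \<le> M" unfolding bounded_iff by blast
    then show ?thesis unfolding wbound_def by (intro exI[of _ M]) simp
  qed
  {
    case 0
    show ?case using b by simp
  next
    case (Suc m)
    have D: "(d k has_vector_derivative d (Suc k) x) (at x)" if x: "x \<in> {-1<..<1}" for x
    proof -
      have "x \<in> interior {-1..1::real}" using x by simp
      then show ?thesis using d[of x k] x at_within_interior by fastforce
    qed
    have "wbounded m (0 - 1) (0 - 1) (d (Suc k))" by (rule wbounded_mono[OF Suc]) auto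
    then have "wbounded m (0 - 1) (0 - 1) (vderiv (d k))"
      by (rule wbounded_cong) (rule vderiv_eqI[OF D])
    moreover have "\<forall>x\<in>{-1<..<1}. d k differentiable (at x)" using differentiableI_vector[OF D] by blast
    ultimately show ?case using b unfolding wbounded.simps by blast
  }
qed

lemma powr_le_two_powr_abs:
  fixes t :: real
  assumes "1 \<le> t" "t \<le> 2"
  shows "t powr p \<le> 2 powr \<bar>p\<bar>"
proof -
  have "t powr p \<le> t powr \<bar>p\<bar>" using assms by (intro powr_mono) auto
  also have "\<dots> \<le> 2 powr \<bar>p\<bar>" using assms by (intro powr_mono2) auto
  finally show ?thesis .
qed

text \<open>The exponents at the two ends are decoupled: \<open>h1\<close> supplies the one at 1 and
  \<open>h2\<close> the one at -1. Near one end the factor of the other end lies between positive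
  constants, and in the middle all weights are comparable.\<close>

lemma wbounded_glue:
  assumes \<delta>: "\<delta> > 0" "\<delta> \<le> 1"
  shows "wbounded m c d h \<Longrightarrow> wbounded m a d h1 \<Longrightarrow> wbounded m c b h2 \<Longrightarrow>
    (\<And>x. x \<in> {1 - \<delta><..<1} \<Longrightarrow> h x = h1 x) \<Longrightarrow> (\<And>x. x \<in> {-1<..<-1 + \<delta>} \<Longrightarrow> h x = h2 x) \<Longrightarrow>
    wbounded m a b h"
proof (induction m arbitrary: a b c d h h1 h2)
  have wb: "wbound a b h" if h: "wbound c d h" "wbound a d h1" "wbound c b h2"
    "\<And>x. x \<in> {1 - \<delta><..<1} \<Longrightarrow> h x = h1 x" "\<And>x. x \<in> {-1<..<-1 + \<delta>} \<Longrightarrow> h x = h2 x" for a b c d h h1 h2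
  proof -
    obtain K0 where K0: "K0 \<ge> 0" "\<And>x. x \<in> {-1<..<1} \<Longrightarrow> norm (h x) \<le> K0 * jacobi_weight c d x"
      using wboundE[OF h(1)] by blast
    obtain K1 where K1: "K1 \<ge> 0" "\<And>x. x \<in> {-1<..<1} \<Longrightarrow> norm (h1 x) \<le> K1 * jacobi_weight a d x"
      using wboundE[OF h(2)] by blast
    obtain K2 where K2: "K2 \<ge> 0" "\<And>x. x \<in> {-1<..<1} \<Longrightarrow> norm (h2 x) \<le> K2 * jacobi_weight c b x"
      using wboundE[OF h(3)] by blast
    obtain M where M: "M \<ge> 0" "\<And>x. x \<in> {-1 + \<delta>..1 - \<delta>} \<Longrightarrow> jacobi_weight (c - a) (d - b) x \<le> M"
      using jacobi_weight_bounded_on_Icc[of "-1 + \<delta>" "1 - \<delta>"] \<delta> by auto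
    define A where "A = K0 * M"
    define B where "B = K1 * 2 powr \<bar>d - b\<bar>"
    define C where "C = K2 * 2 powr \<bar>c - a\<bar>"
    have ABC: "A \<ge> 0" "B \<ge> 0" "C \<ge> 0" using K0 K1 K2 M by (auto simp: A_def B_def C_def)
    have "norm (h x) \<le> (A + B + C) * jacobi_weight a b x" if x: "x \<in> {-1<..<1}" for x
    proof -
      let ?W = "jacobi_weight a b x"
      have split: "jacobi_weight p q x = jacobi_weight (p - a) (q - b) x * ?W" for p q
        using jacobi_weight_mult[OF x, of "p - a" "q - b" a b] by simp
      have key: "norm (h x) \<le> K * L * ?W" if "norm (h x) \<le> K * jacobi_weight p q x"
        "jacobi_weight (p - a) (q - b) x \<le> L" "K \<ge> 0" for K L p q
      proof -
        have "K * jacobi_weight p q x \<le> K * (L * ?W)"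
          unfolding split[of p q] using that by (intro mult_left_mono mult_right_mono) auto
        then show ?thesis using that by (simp add: mult.assoc)
      qed
      consider "x > 1 - \<delta>" | "x < -1 + \<delta>" | "x \<in> {-1 + \<delta>..1 - \<delta>}" by fastforce
      then have "norm (h x) \<le> A * ?W \<or> norm (h x) \<le> B * ?W \<or> norm (h x) \<le> C * ?W"
      proof cases
        case 1
        \<comment> \<open>As \<delta> \<le> 1, here \<open>1 + x\<close> lies between 1 and 2, and
          every power of it is bounded, whatever the sign of the exponent.\<close>
        have "jacobi_weight (a - a) (d - b) x \<le> 2 powr \<bar>d - b\<bar>"
          using powr_le_two_powr_abs[of "1 + x" "d - b"] 1 x \<delta> by (simp add: jacobi_weight_def)
        then show ?thesis using key[of K1 a d] K1 h(4)[of x] 1 x by (auto simp: B_def)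
      next
        case 2
        have "jacobi_weight (c - a) (b - b) x \<le> 2 powr \<bar>c - a\<bar>"
          using powr_le_two_powr_abs[of "1 - x" "c - a"] 2 x \<delta> by (simp add: jacobi_weight_def)
        then show ?thesis using key[of K2 c b] K2 h(5)[of x] 2 x by (auto simp: C_def)
      next
        case 3
        then show ?thesis using key[of K0 c d M] K0 M x by (auto simp: A_def)
      qed
      moreover have "A * ?W \<le> (A + B + C) * ?W" "B * ?W \<le> (A + B + C) * ?W" "C * ?W \<le> (A + B + C) * ?W"
        using ABC by (auto intro!: mult_right_mono)
      ultimately show ?thesis by linarith
    qed
    then show ?thesis unfolding wbound_def by blast
  qed
  {
    case 0
    then show ?case using wb[of c d h a h1 b h2] by simp
  next
    case (Suc m)
    have v1: "vderiv h x = vderiv h1 x" if "x \<in> {1 - \<delta><..<1}" for x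
      unfolding vderiv_def by (rule vector_derivative_cong_open[OF open_greaterThanLessThan that Suc.prems(4)])
    have v2: "vderiv h x = vderiv h2 x" if "x \<in> {-1<..<-1 + \<delta>}" for x
      unfolding vderiv_def by (rule vector_derivative_cong_open[OF open_greaterThanLessThan that Suc.prems(5)])
    have "wbounded m (a - 1) (b - 1) (vderiv h)"
      by (rule Suc.IH[of "c - 1" "d - 1" _ _ "vderiv h1" _ "vderiv h2"]) (use Suc.prems v1 v2 in auto)
    moreover have "wbound a b h" using wb[of c d h a h1 b h2] Suc.prems by simp
    ultimately show ?case using Suc.prems(1) by simp
  }
qed

lemma cweight_nat:
  assumes x: "x \<in> {-1<..<1}"
  shows "cweight (real s) 0 x = of_real ((1 - x) ^ s)" "cweight 0 (real s) x = of_real ((1 + x) ^ s)"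
  using x by (simp_all add: jacobi_weight_def powr_realpow)

text \<open>Near 1 the function is itself a weight with exponent \<open>s\<close>. Near -1 it
  vanishes, so any exponent is correct there, in particular \<open>s\<close>.\<close>

lemma wbounded_phi_plus:
  assumes "is_phi_plus s \<phi>"
  shows "wbounded m (real s) (real s) \<phi>"
proof -
  obtain d where d: "d 0 = \<phi>" "\<And>k x. x \<in> {-1..1} \<Longrightarrow> (d k has_vector_derivative d (Suc k) x) (at x within {-1..1})"
    using assms unfolding is_phi_plus_def smooth_on_Icc_def by blast
  have 0: "wbounded m 0 0 \<phi>" using wbounded_of_smooth[of d m 0, OF d(2)] d(1) by simp
  obtain \<delta> where \<delta>: "\<delta> > 0" "\<And>x. x \<in> {-1..1} \<Longrightarrow> 1 - \<delta> < x \<Longrightarrow> \<phi> x = of_real ((1 - x) ^ s)"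
    "\<And>x. x \<in> {-1..1} \<Longrightarrow> x < -1 + \<delta> \<Longrightarrow> \<phi> x = 0"
    using assms unfolding is_phi_plus_def by blast
  show ?thesis
  proof (rule wbounded_glue[of "min \<delta> 1", OF _ _ 0])
    show "wbounded m (real s) 0 (cweight (real s) 0)" by (rule wbounded_cweight)
    show "wbounded m 0 (real s) (\<lambda>x. 0)" by simp
    show "\<phi> x = cweight (real s) 0 x" if "x \<in> {1 - min \<delta> 1<..<1}" for x
      using that \<delta>(1) \<delta>(2)[of x] cweight_nat(1)[of x s] by auto
    show "\<phi> x = 0" if "x \<in> {-1<..<-1 + min \<delta> 1}" for x
      using that \<delta>(1) \<delta>(3)[of x] by auto
  qed (use \<delta> in auto)
qed

lemma wbounded_phi_minus:
  assumes "is_phi_minus s \<phi>"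
  shows "wbounded m (real s) (real s) \<phi>"
proof -
  obtain d where d: "d 0 = \<phi>" "\<And>k x. x \<in> {-1..1} \<Longrightarrow> (d k has_vector_derivative d (Suc k) x) (at x within {-1..1})"
    using assms unfolding is_phi_minus_def smooth_on_Icc_def by blast
  have 0: "wbounded m 0 0 \<phi>" using wbounded_of_smooth[of d m 0, OF d(2)] d(1) by simp
  obtain \<delta> where \<delta>: "\<delta> > 0" "\<And>x. x \<in> {-1..1} \<Longrightarrow> 1 - \<delta> < x \<Longrightarrow> \<phi> x = 0"
    "\<And>x. x \<in> {-1..1} \<Longrightarrow> x < -1 + \<delta> \<Longrightarrow> \<phi> x = of_real ((1 + x) ^ s)"
    using assms unfolding is_phi_minus_def by blast
  show ?thesis
  proof (rule wbounded_glue[of "min \<delta> 1", OF _ _ 0])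
    show "wbounded m 0 (real s) (cweight 0 (real s))" by (rule wbounded_cweight)
    show "wbounded m (real s) 0 (\<lambda>x. 0)" by simp
    show "\<phi> x = cweight 0 (real s) x" if "x \<in> {-1<..<-1 + min \<delta> 1}" for x
      using that \<delta>(1) \<delta>(3)[of x] cweight_nat(2)[of x s] by auto
    show "\<phi> x = 0" if "x \<in> {1 - min \<delta> 1<..<1}" for x
      using that \<delta>(1) \<delta>(2)[of x] by auto
  qed (use \<delta> in auto)
qed

section \<open>Membership in the maximal domain\<close>

text \<open>The single derivative gives continuity and thereby measurability; the rest is
  boundedness on a finite measure space.\<close>

lemma L2_jacobi_of_wbounded:
  assumes ab: "\<alpha> \<ge> 0" "\<beta> \<ge> 0" and f: "wbounded (Suc 0) 0 0 f"
  shows "f \<in> L2_jacobi \<alpha> \<beta>"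
proof -
  let ?I = "{-1<..<1::real}"
  have lm: "?I \<in> lmeasurable" by simp
  interpret finite_measure "lebesgue_on ?I" by (rule finite_measure_lebesgue_on[OF lm])
  have fc: "continuous_on ?I f"
    using f by (intro continuous_at_imp_continuous_on ballI differentiable_imp_continuous_within) auto
  have wc: "continuous_on ?I (jacobi_weight \<alpha> \<beta>)"
    using has_real_derivative_jacobi_weight by (intro continuous_at_imp_continuous_on ballI DERIV_isCont) blast
  obtain K where K: "K \<ge> 0" "\<And>x. x \<in> ?I \<Longrightarrow> norm (f x) \<le> K * jacobi_weight 0 0 x"
    using wboundE[OF wbounded_imp_wbound[OF f]] by blast
  have fm: "f \<in> borel_measurable (lebesgue_on ?I)"
    by (rule continuous_imp_measurable_on_sets_lebesgue[OF fc]) simp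
  have "integrable (lebesgue_on ?I) (\<lambda>x. (norm (f x))\<^sup>2 * jacobi_weight \<alpha> \<beta> x)"
  proof (rule integrable_const_bound[where B = "K\<^sup>2 * (2 powr \<alpha> * 2 powr \<beta>)"])
    show "(\<lambda>x. (norm (f x))\<^sup>2 * jacobi_weight \<alpha> \<beta> x) \<in> borel_measurable (lebesgue_on ?I)"
      by (rule continuous_imp_measurable_on_sets_lebesgue) (use fc wc in \<open>auto intro!: continuous_intros\<close>)
    show "AE x in lebesgue_on ?I. norm ((norm (f x))\<^sup>2 * jacobi_weight \<alpha> \<beta> x) \<le> K\<^sup>2 * (2 powr \<alpha> * 2 powr \<beta>)"
    proof (rule AE_I2)
      fix x assume "x \<in> space (lebesgue_on ?I)"
      then have x: "x \<in> ?I" by simp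
      have "norm (f x) \<le> K" using K(2)[OF x] x by simp
      then have "(norm (f x))\<^sup>2 * jacobi_weight \<alpha> \<beta> x \<le> K\<^sup>2 * (2 powr \<alpha> * 2 powr \<beta>)"
        using jacobi_weight_le[OF x ab] by (intro mult_mono power_mono) auto
      then show "norm ((norm (f x))\<^sup>2 * jacobi_weight \<alpha> \<beta> x) \<le> K\<^sup>2 * (2 powr \<alpha> * 2 powr \<beta>)"
        by (simp add: abs_mult)
    qed
  qed
  then show ?thesis using fm by (simp add: L2_jacobi_def)
qed

lemma wbounded_jacobi_expr_pow:
  "wbounded (m + 2 * n) a b f \<Longrightarrow> wbounded m (a - real n) (b - real n) (jacobi_expr_pow n \<alpha> \<beta> f)"
proof (induction n arbitrary: m)
  case 0
  then show ?case by (simp add: jacobi_expr_pow_def)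
next
  case (Suc n)
  have "wbounded (Suc (Suc m)) (a - real n) (b - real n) (jacobi_expr_pow n \<alpha> \<beta> f)"
    using Suc.IH[of "Suc (Suc m)"] Suc.prems by simp
  then have "wbounded m (a - real n - 1) (b - real n - 1) (jacobi_expr \<alpha> \<beta> (jacobi_expr_pow n \<alpha> \<beta> f))"
    by (rule wbounded_jacobi_expr)
  moreover have "a - real n - 1 = a - real (Suc n)" "b - real n - 1 = b - real (Suc n)" by simp_all
  moreover have "jacobi_expr \<alpha> \<beta> (jacobi_expr_pow n \<alpha> \<beta> f) = jacobi_expr_pow (Suc n) \<alpha> \<beta> f"
    by (simp add: jacobi_expr_pow_def)
  ultimately show ?case by (simp only:)
qed

text \<open>Each application of \<open>jacobi_expr\<close> costs one power, so after
  \<open>n\<close> of them the exponents have dropped from \<open>n\<close> to 0 and the result is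
  still bounded.\<close>

lemma D_max_of_wbounded:
  assumes ab: "\<alpha> \<ge> 0" "\<beta> \<ge> 0" and f: "\<And>m. wbounded m (real n) (real n) f"
  shows "f \<in> D_max n \<alpha> \<beta>"
proof -
  have "f \<in> L2_jacobi \<alpha> \<beta>"
    by (rule L2_jacobi_of_wbounded[OF ab]) (rule wbounded_mono[OF f], auto)
  moreover have "times_differentiable (2 * n - 1) f"
    unfolding times_differentiable_def using wbounded_imp_differentiable[OF f[of "2 * n"]] by auto
  moreover have "AC_loc (nderiv j f)" for j
    by (rule AC_loc_wbounded[OF wbounded_nderiv[OF f]])
  moreover have "jacobi_expr_pow n \<alpha> \<beta> f \<in> L2_jacobi \<alpha> \<beta>"
    by (rule L2_jacobi_of_wbounded[OF ab])
       (use wbounded_jacobi_expr_pow[OF f, of "Suc 0" n] in simp)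
  ultimately show ?thesis by (simp add: D_max_def)
qed

section \<open>Vanishing of the boundary form at the ends\<close>

lemma wbound_tendsto_0:
  assumes h: "wbound a b h" and ab: "a > 0" "b > 0"
  shows "(h \<longlongrightarrow> 0) (at_left 1)" "(h \<longlongrightarrow> 0) (at_right (-1))"
proof -
  obtain K where K: "\<And>x. x \<in> {-1<..<1} \<Longrightarrow> norm (h x) \<le> K * jacobi_weight a b x"
    using h unfolding wbound_def by blast
  have left: "\<forall>\<^sub>F x in at_left 1. x \<in> {-1<..<1::real}"
    by (rule eventually_at_leftI[of "-1"]) auto
  have right: "\<forall>\<^sub>F x in at_right (-1). x \<in> {-1<..<1::real}"
    by (rule eventually_at_rightI[of _ 1]) auto
  have t0: "((\<lambda>x. 1 - x) \<longlongrightarrow> 0) (at_left (1::real))" "((\<lambda>x. 1 + x) \<longlongrightarrow> 0) (at_right (-1::real))"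
    by (rule tendsto_eq_intros | simp)+
  have t2: "((\<lambda>x. 1 + x) \<longlongrightarrow> 2) (at_left (1::real))" "((\<lambda>x. 1 - x) \<longlongrightarrow> 2) (at_right (-1::real))"
    by (rule tendsto_eq_intros | simp)+
  have l: "((\<lambda>x. (1 - x) powr a * (1 + x) powr b) \<longlongrightarrow> 0 * 2 powr b) (at_left 1)"
    by (rule tendsto_mult[OF tendsto_zero_powrI[OF t0(1) tendsto_const] tendsto_powr[OF t2(1) tendsto_const]])
       (use ab left in \<open>auto elim: eventually_mono\<close>)
  have r: "((\<lambda>x. (1 - x) powr a * (1 + x) powr b) \<longlongrightarrow> 2 powr a * 0) (at_right (-1))"
    by (rule tendsto_mult[OF tendsto_powr[OF t2(2) tendsto_const] tendsto_zero_powrI[OF t0(2) tendsto_const]])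
       (use ab right in \<open>auto elim: eventually_mono\<close>)
  have L: "((\<lambda>x. K * jacobi_weight a b x) \<longlongrightarrow> 0) (at_left 1)"
    using tendsto_mult_left[OF l, of K] by (simp add: jacobi_weight_def)
  have R: "((\<lambda>x. K * jacobi_weight a b x) \<longlongrightarrow> 0) (at_right (-1))"
    using tendsto_mult_left[OF r, of K] by (simp add: jacobi_weight_def)
  have "\<forall>\<^sub>F x in at_left 1. norm (h x) \<le> K * jacobi_weight a b x"
    using left by (rule eventually_mono) (rule K)
  then show "(h \<longlongrightarrow> 0) (at_left 1)" using L by (rule Lim_null_comparison)
  have "\<forall>\<^sub>F x in at_right (-1). norm (h x) \<le> K * jacobi_weight a b x"
    using right by (rule eventually_mono) (rule K)
  then show "(h \<longlongrightarrow> 0) (at_right (-1))" using R by (rule Lim_null_comparison)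
qed

lemma wbounded_lagrangian_coeff: "wbounded m (\<alpha> + real k) (\<beta> + real k) (lagrangian_coeff C \<alpha> \<beta> k)"
  by (rule wbounded_cong[OF wbounded_cmult[OF wbounded_cweight, where c = "of_real (C k)"]])
     (simp add: lagrangian_coeff_def jacobi_weight_def)

text \<open>At the end 1 the coefficient contributes \<open>\<alpha> + k\<close>, and k + (k - j) +
  (j - 1) = 2k - 1 derivatives are taken in all. By \<open>s\<close> this leaves n - k + 1/2, which
  is at least 1/2; likewise at -1. The roles of \<open>u\<close> and \<open>v\<close> are open
  because the two halves of the form exchange them.\<close>

lemma wbound_lagrangian_product:
  assumes u: "wbounded (p + k) a b u" and v: "wbounded q c d v" and kp: "k \<le> n"
    and jk: "1 \<le> j" "j \<le> k" "k - j \<le> p" "j - 1 \<le> q"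
    and s: "\<alpha> + a + c = n - 1 / 2" "\<beta> + b + d = n - 1 / 2"
  shows "wbound (1 / 2) (1 / 2)
    (\<lambda>x. nderiv (k - j) (\<lambda>y. jacobi_coeff N \<alpha> \<beta> k y * nderiv k u y) x * nderiv (j - 1) v x)"
proof -
  have "wbounded p (\<alpha> + real k + (a - real k)) (\<beta> + real k + (b - real k)) (\<lambda>y. jacobi_coeff N \<alpha> \<beta> k y * nderiv k u y)"
    unfolding jacobi_coeff_def by (rule wbounded_mult[OF wbounded_lagrangian_coeff wbounded_nderiv[OF u]])
  then have "wbounded (0 + (k - j)) (\<alpha> + a) (\<beta> + b) (\<lambda>y. jacobi_coeff N \<alpha> \<beta> k y * nderiv k u y)"
    using jk wbounded_le by simp
  from wbounded_nderiv[OF this]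
  have 1: "wbound (\<alpha> + a - real (k - j)) (\<beta> + b - real (k - j)) (nderiv (k - j) (\<lambda>y. jacobi_coeff N \<alpha> \<beta> k y * nderiv k u y))"
    by simp
  have "wbounded (0 + (j - 1)) c d v" using jk v wbounded_le by simp
  from wbounded_nderiv[OF this]
  have 2: "wbound (c - real (j - 1)) (d - real (j - 1)) (nderiv (j - 1) v)" by simp
  show ?thesis
    by (rule wbound_mono[OF wbound_mult[OF 1 2]]) (use s jk kp in \<open>auto simp: of_nat_diff\<close>)
qed

lemma wbound_jacobi_form:
  assumes f: "wbounded (2 * n) (real n) (real n) f"
    and g: "wbounded (2 * n - 1) (- (\<alpha> + 1 / 2)) (- (\<beta> + 1 / 2)) g"
  shows "wbound (1 / 2) (1 / 2) (jacobi_form n \<alpha> \<beta> f g)"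
  unfolding jacobi_form_def
proof (intro wbound_sum)
  fix k j assume "k \<in> {1..n}" "j \<in> {1..k}"
  then have kj: "1 \<le> j" "j \<le> k" "k \<le> n" by auto
  let ?T1 = "\<lambda>x. nderiv (k - j) (\<lambda>y. jacobi_coeff n \<alpha> \<beta> k y * nderiv k (\<lambda>z. cnj (g z)) y) x * nderiv (j - 1) f x"
  let ?T2 = "\<lambda>x. nderiv (k - j) (\<lambda>y. jacobi_coeff n \<alpha> \<beta> k y * nderiv k f y) x * nderiv (j - 1) (\<lambda>z. cnj (g z)) x"
  have g': "wbounded (2 * n - 1) (- (\<alpha> + 1 / 2)) (- (\<beta> + 1 / 2)) (\<lambda>z. cnj (g z))"
    by (rule wbounded_cnj[OF g])
  have 1: "wbound (1 / 2) (1 / 2) ?T1"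
    \<comment> \<open>Here \<open>g\<close> is differentiated 2k - j times; since \<open>k\<close>
      is at most \<open>n\<close> and \<open>j\<close> at least 1, the available 2n - 1 derivatives
      are enough.\<close>
    by (rule wbound_lagrangian_product[where p = "2 * n - 1 - k" and n = n, OF _ f])
       (use kj g' in auto)
  have 2: "wbound (1 / 2) (1 / 2) ?T2"
    by (rule wbound_lagrangian_product[where p = "2 * n - k" and n = n, OF _ g'])
       (use kj f in auto)
  have c: "wbound (0 + 1 / 2) (0 + 1 / 2) (\<lambda>x. z * h x)" if "wbound (1 / 2) (1 / 2) h" for z h
    by (rule wbound_mult[OF wbound_const that])
  have "wbound (1 / 2) (1 / 2) (\<lambda>x. (-1) ^ (k + j) * (?T1 x + (- 1) * ?T2 x))"
    using c[OF wbound_add[OF 1], of "\<lambda>x. (- 1) * ?T2 x" "(-1) ^ (k + j)"] c[OF 2, of "- 1"] by simp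
  then show "wbound (1 / 2) (1 / 2) (\<lambda>x. (-1) ^ (k + j) * (?T1 x - ?T2 x))" by simp
qed

lemma D_min_of_wbounded:
  assumes ab: "\<alpha> \<ge> 0" "\<beta> \<ge> 0" and n: "n \<ge> 1" and f: "\<And>m. wbounded m (real n) (real n) f"
  shows "f \<in> D_min n \<alpha> \<beta>"
proof -
  have "(jacobi_form n \<alpha> \<beta> f g \<longlongrightarrow> 0) (at_left 1) \<and> (jacobi_form n \<alpha> \<beta> f g \<longlongrightarrow> 0) (at_right (-1))"
    if "g \<in> D_max n \<alpha> \<beta>" for g
    using wbound_tendsto_0[OF wbound_jacobi_form[OF f D_max_imp_wbounded[OF ab n that]]] by simp
  then show ?thesis using D_max_of_wbounded[OF ab f] unfolding D_min_def by fastforce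
qed

theorem theorem4p2:
  fixes \<alpha> \<beta> :: real and n s :: nat
  assumes "0 \<le> \<alpha>" and "\<alpha> < 1" and "0 \<le> \<beta>" and "\<beta> < 1"
    and "1 \<le> n" and "n \<le> s"
  shows "(\<forall>\<phi>. is_phi_plus s \<phi> \<longrightarrow> \<phi> \<in> D_min n \<alpha> \<beta>) \<and>
         (\<forall>\<phi>. is_phi_minus s \<phi> \<longrightarrow> \<phi> \<in> D_min n \<alpha> \<beta>)"
proof -
  have "\<phi> \<in> D_min n \<alpha> \<beta>" if "is_phi_plus s \<phi> \<or> is_phi_minus s \<phi>" for \<phi>
  proof (rule D_min_of_wbounded[OF assms(1,3,5)])
    have "wbounded m (real s) (real s) \<phi>" for m
      using that wbounded_phi_plus wbounded_phi_minus by blast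
    then show "wbounded m (real n) (real n) \<phi>" for m
      \<comment> \<open>The condition \<open>n \<le> s\<close> enters here: larger exponents give
        smaller classes.\<close>
      by (rule wbounded_mono) (use assms(6) in auto)
  qed
  then show ?thesis by blast
qed

end
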